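(* Let $n\ge 4$ be an even integer and let $D$ be the $(2n-1)\times(2n-1)$ distance matrix of the gear graph $G_n$ (described in the context). Then the Moore–Penrose inverse of $D$ is \[D^\dagger=-\frac12 L_{even}+\frac{n-1}{2}uu',\] where \[u=\Big(\frac{-(3n-13)}{n^2+3n-4},\ \frac{-(n-6)}{n^2+3n-4}\mathbf{1}_{n-1}',\ \frac{1}{n+4}\mathbf{1}_{n-1}'\Big)'.\]
   Context: Notation: $\mathbf{1}_p$ is the all-ones column vector in $\mathbb{R}^p$, $J_p=\mathbf{1}_p\mathbf{1}_p'$, $I_p$ is the $p\times p$ identity; $X'$ is the transpose and $X^\dagger$ the Moore–Penrose inverse. For numbers $a_1,\dots,a_p$, $\mathrm{Circ}(a_1,\dots,a_p)$ is the $p\times p$ circulant matrix with first row $(a_1,\dots,a_p)$, each subsequent row being the previous one shifted cyclically one position to the right (second row $(a_p,a_1,\dots,a_{p-1})$). Let $S=\mathrm{Circ}(1,3,\dots,3,1)$ (size $n-1$, with $n-3$ entries equal to $3$) and $T=\mathrm{Circ}(0,2,4,\dots,4,2)$ (size $n-1$, with $n-4$ entries equal to $4$). The gear graph $G_n$ is obtained from the wheel graph on $n$ vertices by inserting a new vertex on each edge of the outer cycle; labelling the center first, then the $n-1$ outer-cycle vertices in cyclic order, then the inserted vertices (the $i$-th inserted vertex lying between the $i$-th and $(i+1)$-th cycle vertices, cyclically), its distance matrix is \[D=\begin{bmatrix}0&\mathbf{1}_{n-1}'&2\mathbf{1}_{n-1}'\\ \mathbf{1}_{n-1}&2(J_{n-1}-I_{n-1})&S\\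 2\mathbf{1}_{n-1}&S'&T\end{bmatrix}.\] For $k=1,\dots,n-2$ let $\phi_k=\cos(\frac{\pi k}{n-1})$ (nonzero since $n-1$ is odd), $C_k=\mathrm{Circ}(1,\cos\frac{2\pi k}{n-1},\cos\frac{4\pi k}{n-1},\dots,\cos\frac{2\pi(n-2)k}{n-1})$ and $\widetilde{C_k}=\mathrm{Circ}(\cos\frac{2\pi k}{n-1},\dots,\cos\frac{2\pi(n-2)k}{n-1},1)$. Define \[A=\frac{9(n-1)}{(n+4)^2}\begin{bmatrix}1&\frac{n-2}{3(n-1)}\mathbf{1}_{n-1}'&\frac{-(n+1)}{3(n-1)}\mathbf{1}_{n-1}'\\ \frac{n-2}{3(n-1)}\mathbf{1}_{n-1}&\frac{(n-2)^2}{9(n-1)^2}J_{n-1}&\frac{-(n-2)(n+1)}{9(n-1)^2}J_{n-1}\\ \frac{-(n+1)}{3(n-1)}\mathbf{1}_{n-1}&\frac{-(n-2)(n+1)}{9(n-1)^2}J_{n-1}&\frac{(n+1)^2}{9(n-1)^2}J_{n-1}\end{bmatrix},\] \[B_k=\frac{2}{(n-1)(2\phi_k+\frac{1}{2\phi_k})^2}\begin{bmatrix}0&\mathbf{0}&\mathbf{0}\\ \mathbf{0}&\frac{C_k}{4\phi_k^2}&\frac{C_k+\widetilde{C_k}}{4\phi_k^2}\\ \mathbf{0}&\frac{C_k+\widetilde{C_k}'}{4\phi_k^2}&C_k\end{bmatrix},\] and $L_{even}=A+\sum_{k=1}^{(n-2)/2}B_k$. *)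

theory Defs
  imports "Jordan_Normal_Form.Matrix" "Graph_Theory.Graph_Theory" Complex_Main
begin

section \<open>Moore--Penrose inverse of a real matrix\<close>

definition is_mp_inverse :: "real mat \<Rightarrow> real mat \<Rightarrow> bool" where
  "is_mp_inverse A X \<longleftrightarrow>
     X \<in> carrier_mat (dim_col A) (dim_row A) \<and>
     A * X * A = A \<and> X * A * X = X \<and>
     transpose_mat (A * X) = A * X \<and> transpose_mat (X * A) = X * A"

definition mp_inverse :: "real mat \<Rightarrow> real mat" where
  "mp_inverse A = (THE X. is_mp_inverse A X)"

lemma is_mp_inverse_unique:
  assumes X: "is_mp_inverse A X" and Y: "is_mp_inverse A Y"
  shows "X = Y"
proof -
  define r c where "r = dim_row A" and "c = dim_col A"
  have A: "A \<in> carrier_mat r c" by (auto simp: r_def c_def)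
  have Xc: "X \<in> carrier_mat c r" and Yc: "Y \<in> carrier_mat c r"
    using X Y by (auto simp: is_mp_inverse_def r_def c_def)
  note X' = X[unfolded is_mp_inverse_def] and Y' = Y[unfolded is_mp_inverse_def]
  have AX: "A * X \<in> carrier_mat r r" and AY: "A * Y \<in> carrier_mat r r"
    and XA: "X * A \<in> carrier_mat c c" and YA: "Y * A \<in> carrier_mat c c"
    using A Xc Yc by auto
  have 1: "A * X = A * Y"
  proof -
    have "A * X = transpose_mat ((A * Y * A) * X)" using X' Y' by simp
    also have "(A * Y * A) * X = (A * Y) * (A * X)" using A Xc AY by (simp add: assoc_mult_mat)
    also have "transpose_mat \<dots> = (A * X) * (A * Y)"
      using AX AY X' Y' by (simp add: transpose_mult)
    also have "\<dots> = (A * X * A) * Y" using assoc_mult_mat[OF AX A Yc] by simp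
    also have "\<dots> = A * Y" using X' by simp
    finally show ?thesis .
  qed
  have 2: "X * A = Y * A"
  proof -
    have "X * A = transpose_mat (X * (A * Y * A))" using X' Y' by simp
    also have "X * (A * Y * A) = (X * A) * (Y * A)"
      using A Xc Yc by (simp add: assoc_mult_mat[of _ r c _ r _ c] assoc_mult_mat[of X c r A c _ c])
    also have "transpose_mat \<dots> = (Y * A) * (X * A)"
      using XA YA X' Y' by (simp add: transpose_mult)
    also have "\<dots> = Y * (A * X * A)" 
      using A Xc Yc by (simp add: assoc_mult_mat[of _ r c _ r _ c] assoc_mult_mat[of Y c r A c _ c])
    also have "\<dots> = Y * A" using X' by simp
    finally show ?thesis .
  qed
  have "X = X * A * X" using X' by simp
  also have "\<dots> = Y * (A * X)" using 2 A Xc Yc by (simp add: assoc_mult_mat)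
  also have "\<dots> = Y * A * Y" using 1 A Xc Yc by (simp add: assoc_mult_mat)
  also have "\<dots> = Y" using Y' by simp
  finally show ?thesis .
qed

lemma mp_inverse_eqI: "is_mp_inverse A X \<Longrightarrow> mp_inverse A = X"
  unfolding mp_inverse_def by (blast intro: is_mp_inverse_unique the_equality)


section \<open>Matrix building blocks\<close>

text \<open>Column vectors are represented as one-column matrices.\<close>

definition all_ones :: "nat \<Rightarrow> real mat" where
  "all_ones p = mat p 1 (\<lambda>_. 1)"

definition J_mat :: "nat \<Rightarrow> real mat" where
  "J_mat p = all_ones p * transpose_mat (all_ones p)"

definition circ :: "real list \<Rightarrow> real mat" where
  "circ as = (let p = length as in mat p p (\<lambda>(i, j). as ! ((j + p - i) mod p)))"

definition block3 ::
  "real mat \<Rightarrow> real mat \<Rightarrow> real mat \<Rightarrow>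
   real mat \<Rightarrow> real mat \<Rightarrow> real mat \<Rightarrow>
   real mat \<Rightarrow> real mat \<Rightarrow> real mat \<Rightarrow> real mat" where
  "block3 A11 A12 A13
          A21 A22 A23
          A31 A32 A33 =
     four_block_mat A11 (transpose_mat (transpose_mat A12 @\<^sub>r transpose_mat A13))
                    (A21 @\<^sub>r A31) (four_block_mat A22 A23 A32 A33)"


section \<open>The gear graph and its distance matrix\<close>

text \<open>Vertex \<open>0\<close> is the centre, \<open>1, \<dots>, n-1\<close> are the vertices of the outer cycle in
  cyclic order, so that \<open>i mod (n-1) + 1\<close> is the successor of \<open>i\<close>, and \<open>n-1+i\<close> is the
  vertex inserted on the rim edge from \<open>i\<close> to its successor. Undirected graphs are symmetric
  digraphs, as usual in the graph library.\<close>

definition sym_graph :: "nat set \<Rightarrow> (nat \<times> nat) set \<Rightarrow> (nat, nat \<times> nat) pre_digraph" where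
  "sym_graph V E = \<lparr>verts = V, arcs = E \<union> E\<inverse>, tail = fst, head = snd\<rparr>"

definition spokes :: "nat \<Rightarrow> (nat \<times> nat) set" where
  "spokes n = {(0, i) | i. i \<in> {1..n-1}}"

definition subdivided_rim :: "nat \<Rightarrow> (nat \<times> nat) set" where
  "subdivided_rim n =
     (\<Union>i\<in>{1..n-1}. {(i, n - 1 + i), (n - 1 + i, i mod (n - 1) + 1)})"

definition gear_graph :: "nat \<Rightarrow> (nat, nat \<times> nat) pre_digraph" where
  "gear_graph n = sym_graph {0..<2*n-1} (spokes n \<union> subdivided_rim n)"

text \<open>\<open>wf_digraph.\<mu>\<close> is the infimum of the costs of all walks between two vertices; with
  unit costs this is the usual graph distance.\<close>

definition graph_dist :: "('a, 'b) pre_digraph \<Rightarrow> 'a \<Rightarrow> 'a \<Rightarrow> real" where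
  "graph_dist G u v = real_of_ereal (wf_digraph.\<mu> G (\<lambda>_. 1) u v)"

definition gear_D :: "nat \<Rightarrow> real mat" where
  "gear_D n = mat (2*n-1) (2*n-1) (\<lambda>(i, j). graph_dist (gear_graph n) i j)"

definition S_mat :: "nat \<Rightarrow> real mat" where
  "S_mat n = circ ([1] @ replicate (n - 3) 3 @ [1])"

definition T_mat :: "nat \<Rightarrow> real mat" where
  "T_mat n = circ ([0, 2] @ replicate (n - 4) 4 @ [2])"


section \<open>The matrices of the inversion formula\<close>

definition A_mat :: "nat \<Rightarrow> real mat" where
  "A_mat n =
    (let m = real n - 1; e = all_ones (n - 1); J = J_mat (n - 1) in
     (9 * m / (real n + 4)^2) \<cdot>\<^sub>m block3
       (1\<^sub>m 1)
         (((real n - 2) / (3 * m)) \<cdot>\<^sub>m transpose_mat e)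
           ((- (real n + 1) / (3 * m)) \<cdot>\<^sub>m transpose_mat e)
       (((real n - 2) / (3 * m)) \<cdot>\<^sub>m e)
         (((real n - 2)^2 / (9 * m^2)) \<cdot>\<^sub>m J)
           ((- ((real n - 2) * (real n + 1)) / (9 * m^2)) \<cdot>\<^sub>m J)
       ((- (real n + 1) / (3 * m)) \<cdot>\<^sub>m e)
         ((- ((real n - 2) * (real n + 1)) / (9 * m^2)) \<cdot>\<^sub>m J)
           (((real n + 1)^2 / (9 * m^2)) \<cdot>\<^sub>m J))"

definition gear_phi :: "nat \<Rightarrow> nat \<Rightarrow> real" where
  "gear_phi n k = cos (pi * real k / (real n - 1))"

definition C_mat :: "nat \<Rightarrow> nat \<Rightarrow> real mat" where
  "C_mat n k =
     circ (1 # map (\<lambda>j. cos (2 * pi * real j * real k / (real n - 1))) [1..<n - 1])"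

definition C_tilde :: "nat \<Rightarrow> nat \<Rightarrow> real mat" where
  "C_tilde n k =
     circ (map (\<lambda>j. cos (2 * pi * real j * real k / (real n - 1))) [1..<n - 1] @ [1])"

definition B_mat :: "nat \<Rightarrow> nat \<Rightarrow> real mat" where
  "B_mat n k =
    (let m = n - 1; c = 1 / (4 * (gear_phi n k)^2) in
     (2 / ((real n - 1) * (2 * gear_phi n k + 1 / (2 * gear_phi n k))^2)) \<cdot>\<^sub>m block3
       (0\<^sub>m 1 1) (0\<^sub>m 1 m) (0\<^sub>m 1 m)
       (0\<^sub>m m 1) (c \<cdot>\<^sub>m C_mat n k) (c \<cdot>\<^sub>m (C_mat n k + C_tilde n k))
       (0\<^sub>m m 1) (c \<cdot>\<^sub>m (C_mat n k + transpose_mat (C_tilde n k))) (C_mat n k))"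

definition L_even :: "nat \<Rightarrow> real mat" where
  "L_even n = A_mat n +
     mat (2*n-1) (2*n-1) (\<lambda>ij. \<Sum>k = 1..(n - 2) div 2. B_mat n k $$ ij)"

definition u_vec :: "nat \<Rightarrow> real mat" where
  "u_vec n =
    (let q = (real n)^2 + 3 * real n - 4 in
     ((- (3 * real n - 13) / q) \<cdot>\<^sub>m 1\<^sub>m 1) @\<^sub>r
     ((- (real n - 6) / q) \<cdot>\<^sub>m all_ones (n - 1)) @\<^sub>r
     ((1 / (real n + 4)) \<cdot>\<^sub>m all_ones (n - 1)))"


section \<open>Block form of the distance matrix\<close>

lemma cyc_succ:
  assumes "i \<in> {1..m}"
  shows "i mod m + 1 = (if i = m then 1 else i + 1 :: nat)"
  using assms by auto

lemma arcs_gear_graph: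
  "arcs (gear_graph n) = (\<Union>i\<in>{1..n-1}. let s = (if i = n - 1 then 1 else i + 1) in
     {(0, i), (i, 0), (n - 1 + i, i), (i, n - 1 + i), (n - 1 + i, s), (s, n - 1 + i)})"
proof -
  have "subdivided_rim n =
     (\<Union>i\<in>{1..n-1}. {(i, n - 1 + i), (n - 1 + i, if i = n - 1 then 1 else i + 1)})"
    unfolding subdivided_rim_def
    by (intro SUP_cong refl) (simp only: cyc_succ)
  moreover have "spokes n = (\<Union>i\<in>{1..n-1}. {(0, i)})"
    by (auto simp: spokes_def)
  ultimately show ?thesis
    unfolding gear_graph_def sym_graph_def Let_def
    by (simp only: pre_digraph.select_convs converse_Un converse_UNION UN_Un_distrib[symmetric])
      (auto simp only: converse_iff Un_iff UN_iff insert_iff empty_iff)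
qed

lemma gear_arcE:
  assumes "e \<in> arcs (gear_graph n)"
  obtains i s where "1 \<le> i" "i \<le> n - 1" "s = (if i = n - 1 then 1 else i + 1)"
    "e \<in> {(0, i), (i, 0), (n - 1 + i, i), (i, n - 1 + i), (n - 1 + i, s), (s, n - 1 + i)}"
proof -
  from assms obtain i where "i \<in> {1..n-1}" and
    "e \<in> (let s = (if i = n - 1 then 1 else i + 1) in
      {(0, i), (i, 0), (n - 1 + i, i), (i, n - 1 + i), (n - 1 + i, s), (s, n - 1 + i)})"
    unfolding arcs_gear_graph by (rule UN_E)
  then show thesis
    by (intro that[OF _ _ refl]) (simp_all only: Let_def atLeastAtMost_iff)
qed

lemma gear_graph_simps [simp]:
  "verts (gear_graph n) = {0..<2*n-1}" "tail (gear_graph n) = fst" "head (gear_graph n) = snd"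
  by (simp_all add: gear_graph_def sym_graph_def)

lemma graph_gear_graph:
  assumes "n \<ge> 4"
  shows "graph (gear_graph n)"
proof
  have *: "fst e < 2*n-1 \<and> snd e < 2*n-1 \<and> fst e \<noteq> snd e" if "e \<in> arcs (gear_graph n)" for e
    using that
  proof (rule gear_arcE)
    fix i s
    assume i: "1 \<le> i" "i \<le> n - 1" and s: "s = (if i = n - 1 then 1 else i + 1)"
      and e: "e \<in> {(0, i), (i, 0), (n - 1 + i, i), (i, n - 1 + i), (n - 1 + i, s), (s, n - 1 + i)}"
    have "1 \<le> s" "s \<le> n - 1" using i assms by (auto simp: s)
    with i e assms show ?thesis by auto
  qed
  show "tail (gear_graph n) e \<in> verts (gear_graph n)" if "e \<in> arcs (gear_graph n)" for e
    using *[OF that] by simp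
  show "head (gear_graph n) e \<in> verts (gear_graph n)" if "e \<in> arcs (gear_graph n)" for e
    using *[OF that] by simp
  show "finite (verts (gear_graph n))" by simp
  show "finite (arcs (gear_graph n))" by (simp add: arcs_gear_graph Let_def)
  show "tail (gear_graph n) e \<noteq> head (gear_graph n) e" if "e \<in> arcs (gear_graph n)" for e
    using *[OF that] by simp
  show "e1 = e2" if "e1 \<in> arcs (gear_graph n)" "e2 \<in> arcs (gear_graph n)"
      "arc_to_ends (gear_graph n) e1 = arc_to_ends (gear_graph n) e2" for e1 e2
    using that by (simp add: arc_to_ends_def prod_eq_iff)
  show "symmetric (gear_graph n)"
    unfolding symmetric_conv by (force simp: gear_graph_def sym_graph_def)
qed

lemma graph_dist_eqI:
  fixes f :: "'a \<Rightarrow> nat"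
  assumes "wf_digraph G" and u: "u \<in> verts G"
    and 0: "f v = 0"
    and lip: "\<And>e. e \<in> arcs G \<Longrightarrow> f (tail G e) \<le> f (head G e) + 1"
    and desc: "\<And>w. w \<in> verts G \<Longrightarrow> w \<noteq> v \<Longrightarrow>
      \<exists>e\<in>arcs G. tail G e = w \<and> f w = f (head G e) + 1"
  shows "graph_dist G u v = real (f u)"
proof -
  interpret wf_digraph G by fact
  have lower: "real (f x) \<le> awalk_cost (\<lambda>_. 1) p" if "awalk x p v" for x p
    using that
  proof (induction p arbitrary: x)
    case Nil
    then show ?case using 0 by (simp add: awalk_Nil_iff)
  next
    case (Cons e p)
    then have "e \<in> arcs G" "tail G e = x" "awalk (head G e) p v"
      by (auto simp: awalk_Cons_iff)
    with Cons.IH[of "head G e"] lip[of e] show ?case by simp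
  qed
  have upper: "\<exists>p. awalk x p v \<and> awalk_cost (\<lambda>_. 1) p = real (f x)"
    if "x \<in> verts G" for x
    using that
  proof (induction "f x" arbitrary: x rule: less_induct)
    case less
    show ?case
    proof (cases "x = v")
      case True
      then show ?thesis using less.prems 0 by (intro exI[of _ "[]"]) (simp add: awalk_Nil_iff)
    next
      case False
      then obtain e where e: "e \<in> arcs G" "tail G e = x" "f x = f (head G e) + 1"
        using desc less.prems by blast
      then obtain p where p: "awalk (head G e) p v" "awalk_cost (\<lambda>_. 1) p = real (f (head G e))"
        using less.hyps[of "head G e"] by auto
      then show ?thesis using e by (intro exI[of _ "e # p"]) (auto simp: awalk_Cons_iff)
    qed
  qed
  obtain p where p: "awalk u p v" "awalk_cost (\<lambda>_. 1) p = real (f u)"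
    using upper[OF u] by blast
  have "\<mu> (\<lambda>_. 1) u v = ereal (real (f u))"
  proof (rule antisym)
    show "\<mu> (\<lambda>_. 1) u v \<le> ereal (real (f u))"
      using min_cost_le_walk_cost[OF p(1), of "\<lambda>_. 1"] p(2) by simp
    show "ereal (real (f u)) \<le> \<mu> (\<lambda>_. 1) u v"
      unfolding \<mu>_def using lower by (auto intro!: INF_greatest)
  qed
  then show ?thesis by (simp add: graph_dist_def)
qed

definition gear_dist :: "nat \<Rightarrow> nat \<Rightarrow> nat \<Rightarrow> nat" where
  "gear_dist m u v =
    (let s = (\<lambda>i. if i = m then 1 else i + 1) in
     if u = v then 0
     else if u = 0 then (if v \<le> m then 1 else 2)
     else if v = 0 then (if u \<le> m then 1 else 2)
     else if u \<le> m \<and> v \<le> m then 2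
     else if u \<le> m then (if u = v - m \<or> u = s (v - m) then 1 else 3)
     else if v \<le> m then (if v = u - m \<or> v = s (u - m) then 1 else 3)
     else if u - m = s (v - m) \<or> v - m = s (u - m) then 2 else 4)"

lemma gear_dist_arc:
  assumes m: "m \<ge> 3" and i: "1 \<le> i" "i \<le> m" and s: "s = (if i = m then 1 else i + 1)"
    and v: "v \<le> 2 * m"
    and e: "(x, y) \<in> {(0, i), (m + i, i), (m + i, s)}"
  shows "gear_dist m x v \<le> gear_dist m y v + 1 \<and> gear_dist m y v \<le> gear_dist m x v + 1"
proof -
  define t where "t = (\<lambda>i. if i = m then 1 else i + 1 :: nat)"
  have st: "s = t i" by (simp add: s t_def)
  have t: "1 \<le> t i" "t i \<le> m" using i m by (auto simp: t_def)
  have d: "gear_dist m a b =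
     (if a = b then 0
     else if a = 0 then (if b \<le> m then 1 else 2)
     else if b = 0 then (if a \<le> m then 1 else 2)
     else if a \<le> m \<and> b \<le> m then 2
     else if a \<le> m then (if a = b - m \<or> a = t (b - m) then 1 else 3)
     else if b \<le> m then (if b = a - m \<or> b = t (a - m) then 1 else 3)
     else if a - m = t (b - m) \<or> b - m = t (a - m) then 2 else 4)" for a b
    by (simp add: gear_dist_def Let_def t_def)
  show ?thesis
  proof (cases "v \<le> m")
    case True
    have "gear_dist m 0 v \<le> gear_dist m i v + 1" "gear_dist m i v \<le> gear_dist m 0 v + 1"
      using True i by (auto simp: d)
    moreover have "gear_dist m (m + i) v \<le> gear_dist m i v + 1" "gear_dist m i v \<le> gear_dist m (m + i) v + 1"
      using True i by (auto simp: d)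
    moreover have "gear_dist m (m + i) v \<le> gear_dist m (t i) v + 1" "gear_dist m (t i) v \<le> gear_dist m (m + i) v + 1"
      using True i t by (auto simp: d)
    ultimately show ?thesis using e unfolding st by auto
  next
    case False
    then obtain j where j: "v = m + j" "1 \<le> j" "j \<le> m"
      using v by (intro that[of "v - m"]) auto
    have tj: "1 \<le> t j" "t j \<le> m" using j m by (auto simp: t_def)
    have inj: "t i = t j \<longleftrightarrow> i = j" using i j m by (auto simp: t_def)
    have d0: "gear_dist m 0 v = 2" using j m by (simp add: d)
    have di: "gear_dist m i v = (if i = j \<or> i = t j then 1 else 3)" using i j by (auto simp: d)
    have dt: "gear_dist m (t i) v = (if t i = j \<or> i = j then 1 else 3)"
      using t j inj by (auto simp: d)
    have dm: "gear_dist m (m + i) v = (if i = j then 0 else if i = t j \<or> j = t i then 2 else 4)"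
      using i j by (auto simp: d)
    from e show ?thesis unfolding st by (auto simp: d0 di dt dm)
  qed
qed

lemma graph_dist_gear_graph:
  assumes n: "n \<ge> 4" and u: "u < 2*n-1" and v: "v < 2*n-1"
  shows "graph_dist (gear_graph n) u v = real (gear_dist (n-1) u v)"
proof (rule graph_dist_eqI)
  define m where "m = n - 1"
  have m: "m \<ge> 3" "n - 1 = m" "2*n-1 = 2*m+1" using n by (auto simp: m_def)
  define s where "s = (\<lambda>i. if i = m then 1 else i + 1 :: nat)"
  show "wf_digraph (gear_graph n)"
    using graph_gear_graph[OF n] by (simp add: graph_def digraph_def fin_digraph_def)
  show "u \<in> verts (gear_graph n)" using u by simp
  show "gear_dist (n-1) v v = 0" by (simp add: gear_dist_def)
  show "gear_dist (n-1) (tail (gear_graph n) e) v \<le> gear_dist (n-1) (head (gear_graph n) e) v + 1"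
    if "e \<in> arcs (gear_graph n)" for e
    using that
  proof (rule gear_arcE)
    fix i t
    assume i: "1 \<le> i" "i \<le> n - 1" and t: "t = (if i = n - 1 then 1 else i + 1)"
      and e: "e \<in> {(0, i), (i, 0), (n - 1 + i, i), (i, n - 1 + i), (n - 1 + i, t), (t, n - 1 + i)}"
    note * = gear_dist_arc[OF m(1) i[unfolded m(2)] t[unfolded m(2)], of v]
    have "v \<le> 2*m" using v m by simp
    with e *[of 0 i] *[of "m+i" i] *[of "m+i" t] show ?thesis
      unfolding m(2) by auto
  qed
  show "\<exists>e\<in>arcs (gear_graph n). tail (gear_graph n) e = w \<and>
      gear_dist (n-1) w v = gear_dist (n-1) (head (gear_graph n) e) v + 1"
    if w: "w \<in> verts (gear_graph n)" "w \<noteq> v" for w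
  proof -
    have wv: "w \<le> 2*m" "v \<le> 2*m" using w v m by auto
    have arcs: "(0, i) \<in> arcs (gear_graph n)" "(i, 0) \<in> arcs (gear_graph n)"
      "(m + i, i) \<in> arcs (gear_graph n)" "(i, m + i) \<in> arcs (gear_graph n)"
      "(m + i, s i) \<in> arcs (gear_graph n)" "(s i, m + i) \<in> arcs (gear_graph n)"
      if "1 \<le> i" "i \<le> m" for i
      using that unfolding arcs_gear_graph m(2) s_def Let_def by (auto intro!: bexI[of _ i])
    have arcI: "\<exists>e\<in>arcs (gear_graph n). tail (gear_graph n) e = w \<and>
        gear_dist (n-1) w v = gear_dist (n-1) (head (gear_graph n) e) v + 1"
      if "(w, x) \<in> arcs (gear_graph n)" "gear_dist m w v = gear_dist m x v + 1" for x
      using that m by (intro bexI[of _ "(w,x)"]) auto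
    have s: "1 \<le> s i" "s i \<le> m" if "1 \<le> i" "i \<le> m" for i
      using that m by (auto simp: s_def)
    have d: "gear_dist m a b =
     (if a = b then 0
     else if a = 0 then (if b \<le> m then 1 else 2)
     else if b = 0 then (if a \<le> m then 1 else 2)
     else if a \<le> m \<and> b \<le> m then 2
     else if a \<le> m then (if a = b - m \<or> a = s (b - m) then 1 else 3)
     else if b \<le> m then (if b = a - m \<or> b = s (a - m) then 1 else 3)
     else if a - m = s (b - m) \<or> b - m = s (a - m) then 2 else 4)" for a b
      by (simp add: gear_dist_def Let_def s_def)
    have ins: "\<exists>i. a = m + i \<and> 1 \<le> i \<and> i \<le> m" if "\<not> a \<le> m" "a \<le> 2*m" for a
      using that by (intro exI[of _ "a - m"]) auto
    show ?thesis
    proof (cases "w = 0")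
      case True
      show ?thesis
      proof (cases "v \<le> m")
        case True
        with \<open>w = 0\<close> w arcs(1)[of v] m show ?thesis by (intro arcI[of v]) (auto simp: d)
      next
        case False
        then obtain j where "v = m + j" "1 \<le> j" "j \<le> m" using ins wv by blast
        with \<open>w = 0\<close> arcs(1)[of j] m show ?thesis by (intro arcI[of j]) (auto simp: d)
      qed
    next
      case w0: False
      show ?thesis
      proof (cases "w \<le> m")
        case True
        show ?thesis
        proof (cases "v \<le> m")
          case vm: True
          with True w0 w arcs(2)[of w] m show ?thesis by (intro arcI[of 0]) (auto simp: d)
        next
          case False
          then obtain j where j: "v = m + j" "1 \<le> j" "j \<le> m" using ins wv by blast
          show ?thesis
          proof (cases "w = j \<or> w = s j")
            case t: True
            with True w0 w arcs(4,6)[of j] j m show ?thesis by (intro arcI[of v]) (auto simp: d)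
          next
            case f: False
            with True w0 w arcs(2)[of w] j m show ?thesis by (intro arcI[of 0]) (auto simp: d)
          qed
        qed
      next
        case False
        then obtain i where i: "w = m + i" "1 \<le> i" "i \<le> m" using ins wv by blast
        note si = s[OF i(2,3)] and ai = arcs[OF i(2,3)]
        show ?thesis
        proof (cases "v \<le> m")
          case vm: True
          show ?thesis
          proof (cases "v = i \<or> v = s i")
            case True
            with vm i si ai m show ?thesis by (intro arcI[of v]) (auto simp: d)
          next
            case False
            with vm i si ai m show ?thesis by (intro arcI[of i]) (auto simp: d)
          qed
        next
          case False
          then obtain j where j: "v = m + j" "1 \<le> j" "j \<le> m" using ins wv by blast
          have ij: "i \<noteq> j" using i j w by auto
          show ?thesis
          proof (cases "j = s i")
            case True
            with i j ij si ai m show ?thesis by (intro arcI[of j]) (auto simp: d)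
          next
            case False
            with i j ij si ai m show ?thesis by (intro arcI[of i]) (auto simp: d)
          qed
        qed
      qed
    qed
  qed
qed

lemma J_mat_alt: "J_mat p = mat p p (\<lambda>_. 1)"
  by (rule eq_matI) (auto simp: J_mat_def all_ones_def scalar_prod_def)

lemma cyc_diff_mod:
  fixes i j p :: nat
  assumes "i < p" "j < p"
  shows "(j + p - i) mod p = (if i \<le> j then j - i else j + p - i)"
proof (cases "i \<le> j")
  case True
  then have "j + p - i = (j - i) + p" by simp
  moreover have "(j - i + p) mod p = j - i" using assms by simp
  ultimately show ?thesis using True by (simp only: if_True)
next
  case False
  then have "j + p - i < p" using assms by linarith
  then have "(j + p - i) mod p = j + p - i" by (rule mod_less)
  then show ?thesis using False by (simp only: if_False)
qed

lemma circ_index: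
  assumes "i < length as" "j < length as"
  shows "circ as $$ (i, j) = as ! (if i \<le> j then j - i else j + length as - i)"
proof -
  have "circ as $$ (i, j) = as ! ((j + length as - i) mod length as)"
    unfolding circ_def Let_def using assms by (subst index_mat) simp_all
  then show ?thesis by (simp only: cyc_diff_mod[OF assms])
qed

lemma dim_circ [simp]: "dim_row (circ as) = length as" "dim_col (circ as) = length as"
  by (simp_all add: circ_def Let_def)

lemma S_mat_alt:
  assumes "n \<ge> 4"
  shows "S_mat n = mat (n-1) (n-1) (\<lambda>(i, j). if i = j \<or> i = (if j = n-2 then 0 else j+1) then 1 else 3)"
proof -
  define as :: "real list" where "as = [1] @ replicate (n - 3) 3 @ [1]"
  have len: "length as = n - 1" using assms by (simp add: as_def)
  have nth: "as ! l = (if l = 0 \<or> l = n-2 then 1 else 3)"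
    if "l < n-1" for l
    using that assms by (auto simp: as_def nth_append nth_Cons')
  show ?thesis
    unfolding S_mat_def as_def[symmetric]
  proof (rule eq_matI, goal_cases)
    case (1 i j)
    then have ij: "i < n-1" "j < n-1" by simp_all
    define l where "l = (if i \<le> j then j - i else j + (n-1) - i)"
    have l: "l < n-1" using ij by (auto simp: l_def)
    have eq0: "circ as $$ (i, j) = as ! l" using circ_index[of i as j] ij by (simp add: len l_def)
    note eq = trans[OF eq0 nth[OF l]]
    have l0: "l = 0 \<longleftrightarrow> i = j" using ij by (auto simp: l_def)
    have lq: "l = n - 2 \<longleftrightarrow> i = (if j = n-2 then 0 else j+1)"
      using ij assms by (cases "i \<le> j") (auto simp: l_def)
    show ?case unfolding eq l0 lq using ij by (subst index_mat) simp_all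
  qed (simp_all only: len dim_circ dim_row_mat dim_col_mat)
qed

lemma T_mat_alt:
  assumes "n \<ge> 4"
  shows "T_mat n = mat (n-1) (n-1) (\<lambda>(i, j). if i = j then 0
    else if i = (if j = n-2 then 0 else j+1) \<or> j = (if i = n-2 then 0 else i+1) then 2 else 4)"
proof -
  define as :: "real list" where "as = [0, 2] @ replicate (n - 4) 4 @ [2]"
  have len: "length as = n - 1" using assms by (simp add: as_def)
  have nth: "as ! l = (if l = 0 then 0 else if l = n-2 \<or> l = 1 then 2 else 4)"
    if "l < n-1" for l
    using that assms by (auto simp: as_def nth_append nth_Cons')
  show ?thesis
    unfolding T_mat_def as_def[symmetric]
  proof (rule eq_matI, goal_cases)
    case (1 i j)
    then have ij: "i < n-1" "j < n-1" by simp_all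
    define l where "l = (if i \<le> j then j - i else j + (n-1) - i)"
    have l: "l < n-1" using ij by (auto simp: l_def)
    have eq0: "circ as $$ (i, j) = as ! l" using circ_index[of i as j] ij by (simp add: len l_def)
    note eq = trans[OF eq0 nth[OF l]]
    have l0: "l = 0 \<longleftrightarrow> i = j" using ij by (auto simp: l_def)
    have lq: "l = n - 2 \<longleftrightarrow> i = (if j = n-2 then 0 else j+1)"
      using ij assms by (cases "i \<le> j") (auto simp: l_def)
    have l1: "l = 1 \<longleftrightarrow> j = (if i = n-2 then 0 else i+1)"
      using ij assms by (cases "i \<le> j") (auto simp: l_def)
    show ?case unfolding eq l0 lq l1 using ij by (subst index_mat) simp_all
  qed (simp_all only: len dim_circ dim_row_mat dim_col_mat)
qed

lemma dim_block3 [simp]: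
  "dim_row (block3 A11 A12 A13 A21 A22 A23 A31 A32 A33) = dim_row A11 + (dim_row A22 + dim_row A33)"
  "dim_col (block3 A11 A12 A13 A21 A22 A23 A31 A32 A33) = dim_col A11 + (dim_col A22 + dim_col A33)"
  by (simp_all add: block3_def)

lemma block3_index:
  assumes "A11 \<in> carrier_mat 1 1" "A12 \<in> carrier_mat 1 m" "A13 \<in> carrier_mat 1 m"
    "A21 \<in> carrier_mat m 1" "A22 \<in> carrier_mat m m" "A23 \<in> carrier_mat m m"
    "A31 \<in> carrier_mat m 1" "A32 \<in> carrier_mat m m" "A33 \<in> carrier_mat m m"
    and "i < 2*m+1" "j < 2*m+1"
  shows "block3 A11 A12 A13 A21 A22 A23 A31 A32 A33 $$ (i, j) =
    (if i = 0 then (if j = 0 then A11 $$ (0,0) else if j \<le> m then A12 $$ (0,j-1) else A13 $$ (0,j-1-m))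
     else if i \<le> m then
       (if j = 0 then A21 $$ (i-1,0) else if j \<le> m then A22 $$ (i-1,j-1) else A23 $$ (i-1,j-1-m))
     else
       (if j = 0 then A31 $$ (i-1-m,0) else if j \<le> m then A32 $$ (i-1-m,j-1) else A33 $$ (i-1-m,j-1-m)))"
  using assms by (auto simp: block3_def append_rows_def)

theorem gear_D_block:
  assumes "n \<ge> 4"
  shows "gear_D n =
    (let e = all_ones (n - 1) in block3
      (0\<^sub>m 1 1) (transpose_mat e) (2 \<cdot>\<^sub>m transpose_mat e)
      e (2 \<cdot>\<^sub>m (J_mat (n - 1) - 1\<^sub>m (n - 1))) (S_mat n)
      (2 \<cdot>\<^sub>m e) (transpose_mat (S_mat n)) (T_mat n))"
proof -
  define m where "m = n - 1"
  have m: "m \<ge> 3" "n - 1 = m" "n - 2 = m - 1" "2*n-1 = 2*m+1" using assms by (auto simp: m_def)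
  show ?thesis
    unfolding Let_def S_mat_alt[OF assms] T_mat_alt[OF assms] J_mat_alt m
  proof (rule eq_matI, goal_cases)
    case (1 i j)
    then have ij: "i < 2*m+1" "j < 2*m+1" by auto
    have D: "gear_D n $$ (i, j) = real (gear_dist m i j)"
      using ij graph_dist_gear_graph[OF assms] unfolding gear_D_def m by simp
    consider "i = 0" | a where "i = Suc a" "a < m" | a where "i = Suc (m + a)" "a < m"
      using ij by (cases "i = 0"; cases "i \<le> m") (auto intro: that(2)[of "i-1"] that(3)[of "i-1-m"])
    note ci = this
    consider "j = 0" | a where "j = Suc a" "a < m" | a where "j = Suc (m + a)" "a < m"
      using ij by (cases "j = 0"; cases "j \<le> m") (auto intro: that(2)[of "j-1"] that(3)[of "j-1-m"])
    note cj = this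
    note B = block3_index[OF _ _ _ _ _ _ _ _ _ ij]
    show ?case (is ?goal)
    proof (cases rule: ci)
      case i: 1
      show ?goal
      proof (cases rule: cj)
        case j: 1
        show ?goal using m(1) i j unfolding D
          by (subst B) (auto simp: gear_dist_def all_ones_def)
      next
        case j: (2 b)
        show ?goal using m(1) i j unfolding D
          by (subst B) (auto simp: gear_dist_def all_ones_def)
      next
        case j: (3 b)
        show ?goal using m(1) i j unfolding D
          by (subst B) (auto simp: gear_dist_def all_ones_def)
      qed
    next
      case i: (2 a)
      show ?goal
      proof (cases rule: cj)
        case j: 1
        show ?goal using m(1) i j unfolding D
          by (subst B) (auto simp: gear_dist_def all_ones_def)
      next
        case j: (2 b)
        show ?goal using m(1) i j unfolding D
          by (subst B) (auto simp: gear_dist_def all_ones_def)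
      next
        case j: (3 b)
        show ?goal using m(1) i j unfolding D
          by (subst B) (auto simp: gear_dist_def all_ones_def)
      qed
    next
      case i: (3 a)
      show ?goal
      proof (cases rule: cj)
        case j: 1
        show ?goal using m(1) i j unfolding D
          by (subst B) (auto simp: gear_dist_def all_ones_def)
      next
        case j: (2 b)
        show ?goal using m(1) i j unfolding D
          by (subst B) (auto simp: gear_dist_def all_ones_def)
      next
        case j: (3 b)
        show ?goal using m(1) i j unfolding D
          by (subst B) (auto simp: gear_dist_def all_ones_def)
      qed
    qed
  qed (use m in \<open>auto simp: gear_D_def all_ones_def\<close>)
qed

end

theory Submission
  imports Defs
begin

text \<open>Put \<open>m = n - 1\<close> and place the centre at the origin of \<open>\<real>\<^sup>m\<close>, the rim vertices at the unit vectors
  \<open>e\<^sub>s\<close> and the inserted vertices at \<open>e\<^sub>s + e\<^sub>s\<^sub>+\<^sub>1\<close>. Graph distances are then squared Euclidean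
  distances, so \<open>D = a 1' + 1 a' - 2 K K'\<close>, where the rows of \<open>K\<close> are the points and \<open>a = K 1\<close> is the
  vector of their squared norms. Hence the columns of \<open>D\<close> lie in the span of \<open>1\<close>, \<open>a\<close> and the
  columns of \<open>K\<close>. The Gram matrix \<open>K' K = 3 I + P + P'\<close> is circulant, the block matrices \<open>B\<^sub>k\<close> sum to \<open>K Q K'\<close>
  with \<open>Q\<close> its inverse square off the constant vectors, and the vectors in \<open>A\<close> and \<open>u\<close> lie in the
  span of \<open>1\<close> and \<open>a\<close>. Multiplying out shows that \<open>D\<close> times the claimed inverse \<open>X\<close> is a symmetric
  matrix \<open>E\<close> fixing \<open>1\<close>, \<open>a\<close> and the columns of \<open>K\<close>; so \<open>E D = D\<close>, \<open>E X = X\<close>, and the Penrose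
  equations follow by transposition.\<close>

section \<open>The point configuration of the gear graph\<close>

text \<open>Coordinate \<open>s\<close> of the point of vertex \<open>i\<close>; the weight below is the squared norm of that
  point.\<close>

definition gear_pt :: "nat \<Rightarrow> nat \<Rightarrow> nat \<Rightarrow> real" where
  "gear_pt m i s = (if i = 0 then 0 else if i \<le> m then of_bool (s = i - 1)
     else of_bool (s = i - 1 - m) + of_bool (s = Suc (i - 1 - m) mod m))"

definition gear_wt :: "nat \<Rightarrow> nat \<Rightarrow> real" where
  "gear_wt m i = (if i = 0 then 0 else if i \<le> m then 1 else 2)"

lemma sum_gear_vertices:
  fixes f :: "nat \<Rightarrow> real"
  shows "(\<Sum>l<2*m+1. f l) = f 0 + (\<Sum>s<m. f (Suc s)) + (\<Sum>s<m. f (Suc (m + s)))"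
proof -
  have "(\<Sum>l<2*m+1. f l) = f 0 + (\<Sum>s<m+m. f (Suc s))"
    by (simp add: sum.lessThan_Suc_shift mult_2 del: sum.lessThan_Suc)
  also have "(\<Sum>s<m+k. f (Suc s)) = (\<Sum>s<m. f (Suc s)) + (\<Sum>s<k. f (Suc (m + s)))" for k
    by (induction k) simp_all
  finally show ?thesis by simp
qed

section \<open>Cyclic shifts and the action of \<open>K\<close> and \<open>K'\<close>\<close>

lemma mod_Suc_eq_iff_pred:
  assumes "s < m" "r < m"
  shows "s = Suc r mod m \<longleftrightarrow> r = (s + m - 1) mod m"
proof -
  have "Suc r mod m = (if Suc r = m then 0 else Suc r)" using assms by auto
  \<comment> \<open>Adding \<open>m\<close> first keeps the truncated subtraction exact at
    \<open>s = 0\<close>.\<close>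
  moreover have "(s + m - 1) mod m = (if s = 0 then m - 1 else s - 1)"
  proof (cases s)
    case (Suc q)
    then have "s + m - 1 = q + m" by simp
    then show ?thesis using Suc assms by simp
  qed (use assms in auto)
  ultimately show ?thesis using assms by auto
qed

text \<open>The cyclic shift is a permutation, so its transpose is its inverse.\<close>

lemma sum_cyc_succ:
  fixes f g :: "nat \<Rightarrow> real"
  assumes "m > 0"
  shows "(\<Sum>s<m. f s * g (Suc s mod m)) = (\<Sum>s<m. f ((s + m - 1) mod m) * g s)"
proof -
  have "Suc s mod m < m" "(s + m - 1) mod m < m" for s using assms by auto
  then show ?thesis
    using mod_Suc_eq_iff_pred[of _ m]
    by (intro sum.reindex_bij_witness[where i = "\<lambda>s. (s + m - 1) mod m" and j = "\<lambda>s. Suc s mod m"])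
      (metis lessThan_iff)+
qed

text \<open>A row of \<open>K\<close> is zero, a unit vector or a sum of two unit vectors, so an
  entry of \<open>K z\<close> reads off at most two entries of \<open>z\<close>.\<close>

lemma gear_pt_apply:
  assumes "i < 2*m+1" "m > 0"
  shows "(\<Sum>s<m. gear_pt m i s * z s) =
    (if i = 0 then 0 else if i \<le> m then z (i - 1) else z (i - 1 - m) + z (Suc (i - 1 - m) mod m))"
proof -
  have *: "(\<Sum>s<m. of_bool (s = r) * z s) = z r" if "r < m" for r
    using that by (simp add: of_bool_def if_distrib[where f = "\<lambda>x. x * _"] cong: if_cong)
  have "i - 1 < m" if "i \<noteq> 0" "i \<le> m" using that by auto
  moreover have "i - 1 - m < m" if "\<not> i \<le> m" using that assms by auto
  ultimately show ?thesis
    using assms by (auto simp: gear_pt_def distrib_right sum.distrib *)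
qed

text \<open>Coordinate \<open>s\<close> is carried by the rim vertex \<open>Suc s\<close> and the
  two inserted vertices beside it, one of them indexed by the cyclic predecessor of
  \<open>s\<close>.\<close>

lemma gear_pt_adjoint:
  assumes "s < m"
  shows "(\<Sum>l<2*m+1. gear_pt m l s * x l) =
    x (Suc s) + x (Suc (m + s)) + x (Suc (m + (s + m - 1) mod m))"
proof -
  have *: "(\<Sum>r<m. of_bool (q = r) * f r) = f q" if "q < m" for q and f :: "nat \<Rightarrow> real"
    using that by (simp add: of_bool_def if_distrib[where f = "\<lambda>x. x * _"] cong: if_cong)
  have "(\<Sum>r<m. of_bool (s = Suc r mod m) * x (Suc (m + r))) =
      (\<Sum>r<m. of_bool ((s + m - 1) mod m = r) * x (Suc (m + r)))"
    using assms mod_Suc_eq_iff_pred[OF assms] by (intro sum.cong refl) auto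
  also have "\<dots> = x (Suc (m + (s + m - 1) mod m))"
    using assms by (subst *) auto
  finally show ?thesis
    using assms unfolding sum_gear_vertices
    by (simp add: gear_pt_def distrib_right sum.distrib *[of s])
qed

lemma gear_pt_gram:
  assumes "s < m"
  shows "(\<Sum>l<2*m+1. gear_pt m l s * (\<Sum>t<m. gear_pt m l t * z t)) =
    3 * z s + z (Suc s mod m) + z ((s + m - 1) mod m)"
proof -
  have m: "m > 0" and p: "(s + m - 1) mod m < m" using assms by auto
  \<comment> \<open>The rim edge starting at the predecessor of \<open>s\<close> ends at
    \<open>s\<close>; this supplies the third copy of \<open>z s\<close>.\<close>
  have "Suc ((s + m - 1) mod m) mod m = s"
    using mod_Suc_eq_iff_pred[OF assms p] by simp
  then show ?thesis
    unfolding gear_pt_adjoint[OF assms] using assms m p by (subst (1 2 3) gear_pt_apply) auto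
qed

lemma sum_gear_wt: "(\<Sum>l<2*m+1. gear_wt m l) = 3 * real m"
  unfolding sum_gear_vertices by (simp add: gear_wt_def)

lemma sum_gear_wt_square: "(\<Sum>l<2*m+1. gear_wt m l * gear_wt m l) = 5 * real m"
  unfolding sum_gear_vertices by (simp add: gear_wt_def)

lemma gear_wt_eq_sum: "i < 2*m+1 \<Longrightarrow> m > 0 \<Longrightarrow> gear_wt m i = (\<Sum>s<m. gear_pt m i s)"
  using gear_pt_apply[of i m "\<lambda>_. 1"] by (simp add: gear_wt_def)

lemma sum_gear_pt: "s < m \<Longrightarrow> (\<Sum>l<2*m+1. gear_pt m l s) = 3"
  using gear_pt_adjoint[of s m "\<lambda>_. 1"] by simp

lemma sum_gear_pt_wt: "s < m \<Longrightarrow> (\<Sum>l<2*m+1. gear_pt m l s * gear_wt m l) = 5"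
  using gear_pt_adjoint[of s m "gear_wt m"] by (simp add: gear_wt_def)

lemma gear_vertex_cases:
  assumes "i < 2*m+1"
  obtains (hub) "i = 0" | (rim) a where "i = Suc a" "a < m" | (ins) a where "i = Suc (m + a)" "a < m"
proof (cases "i = 0 \<or> i \<le> m")
  case True
  then show thesis using hub rim[of "i - 1"] by fastforce
next
  case False
  then show thesis using ins[of "i - 1 - m"] assms by fastforce
qed

text \<open>The right side is the expanded squared Euclidean distance of two points; it is compared
  with the block form for each pair of vertex types.\<close>

lemma gear_D_index:
  assumes n: "n \<ge> 4" and m: "m = n - 1" and ij: "i < 2*m+1" "j < 2*m+1"
  shows "gear_D n $$ (i, j) =
    gear_wt m i + gear_wt m j - 2 * (\<Sum>s<m. gear_pt m i s * gear_pt m j s)"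
proof -
  have m3: "m \<ge> 3" "m > 0" and n2: "n - 2 = m - 1" "n - 1 = m" using assms by auto
  define sc where "sc = (\<lambda>r. if r = m - 1 then 0 else r + 1)"
  have sc: "Suc r mod m = sc r" "sc r < m" "sc r \<noteq> r" if "r < m" for r
    using that m3 by (auto simp: sc_def)
  \<comment> \<open>On a cycle of length at least three no two vertices succeed each other, so
    distinct inserted vertices share at most one coordinate.\<close>
  have sc2: "sc r = sc q \<longleftrightarrow> r = q" "sc r = q \<Longrightarrow> sc q \<noteq> r" if "r < m" "q < m" for r q
    using that m3 by (auto simp: sc_def split: if_splits)
  have S: "S_mat n $$ (a, b) = (if a = b \<or> a = sc b then 1 else 3)" if "a < m" "b < m" for a b
    using that unfolding S_mat_alt[OF n] n2 by (simp add: sc_def)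
  have T: "T_mat n $$ (a, b) = (if a = b then 0 else if a = sc b \<or> b = sc a then 2 else 4)"
    if "a < m" "b < m" for a b
    using that unfolding T_mat_alt[OF n] n2 by (simp add: sc_def)
  have ST: "S_mat n \<in> carrier_mat m m" "T_mat n \<in> carrier_mat m m"
    unfolding S_mat_alt[OF n] T_mat_alt[OF n] n2 by auto
  have D: "gear_D n $$ (i, j) =
    (if i = 0 then (if j = 0 then 0 else if j \<le> m then 1 else 2)
     else if i \<le> m then
       (if j = 0 then 1 else if j \<le> m then (if i = j then 0 else 2) else S_mat n $$ (i-1,j-1-m))
     else
       (if j = 0 then 2 else if j \<le> m then S_mat n $$ (j-1, i-1-m) else T_mat n $$ (i-1-m,j-1-m)))"
    unfolding gear_D_block[OF n] Let_def J_mat_alt n2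
    by (subst block3_index[where m = m]) (use ij m3(2) ST in \<open>auto simp: all_ones_def\<close>)
  note eqs = D gear_pt_apply[OF ij(1) m3(2)]
  from ij(1) show ?thesis
  proof (cases rule: gear_vertex_cases)
    case hub
    with ij(2) show ?thesis unfolding eqs
      by (cases rule: gear_vertex_cases) (auto simp: gear_wt_def)
  next
    case (rim a)
    with ij(2) show ?thesis unfolding eqs
      by (cases rule: gear_vertex_cases) (auto simp: gear_wt_def gear_pt_def S sc sc(3)[symmetric])
  next
    case (ins a)
    from ij(2) show ?thesis
    proof (cases rule: gear_vertex_cases)
      case hub
      with ins show ?thesis unfolding eqs by (auto simp: gear_wt_def gear_pt_def)
    next
      case (rim b)
      with ins show ?thesis unfolding eqs by (auto simp: gear_wt_def gear_pt_def S sc sc(3)[symmetric])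
    next
      case (ins b)
      have "sc a \<noteq> a" "sc b \<noteq> b" "sc a = sc b \<longleftrightarrow> a = b" "sc a = b \<Longrightarrow> sc b \<noteq> a"
        using sc(3) sc2 \<open>a < m\<close> ins by auto
      then show ?thesis
        unfolding eqs using ins \<open>i = _\<close> \<open>a < m\<close> by (auto simp: gear_wt_def gear_pt_def T sc(1))
    qed
  qed
qed

section \<open>Cosine kernels on the cycle\<close>

text \<open>With \<open>P\<close> the cyclic shift, the Gram matrix \<open>3 I + P + P'\<close> of the coordinates has the
  eigenvalue \<open>gear_eig m k\<close> on the \<open>k\<close>-th Fourier mode. So \<open>cyc_kernel p\<close> is its \<open>-p\<close>-th power on the
  orthogonal complement of the constant vectors (\<open>m\<close> odd).\<close>

definition gear_eig :: "nat \<Rightarrow> nat \<Rightarrow> real" where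
  "gear_eig m k = 3 + 2 * cos (2 * pi * real k / real m)"

definition cyc_kernel :: "nat \<Rightarrow> nat \<Rightarrow> nat \<Rightarrow> nat \<Rightarrow> real" where
  "cyc_kernel p m s t = (\<Sum>k = 1..(m - 1) div 2.
     2 / (real m * gear_eig m k ^ p) * cos (2 * pi * real k * (real s - real t) / real m))"

lemma gear_eig_pos: "gear_eig m k > 0"
  using cos_ge_minus_one[of "2 * pi * real k / real m"] unfolding gear_eig_def by linarith

lemma cos_shift_period:
  assumes "m > 0"
  shows "cos (2 * pi * real k * (x + real m * real q) / real m) = cos (2 * pi * real k * x / real m)"
proof -
  have "2 * pi * real k * (x + real m * real q) / real m =
      2 * pi * real k * x / real m + 2 * real (k * q) * pi"
    using assms by (simp add: field_simps)
  then show ?thesis by (simp only: cos_add cos_2npi sin_2npi mult_1_right mult_zero_right diff_zero)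
qed

lemma cos_mod_period:
  assumes "m > 0"
  shows "cos (2 * pi * real k * (real (s mod m) - x) / real m) = cos (2 * pi * real k * (real s - x) / real m)"
proof -
  have "real s - x = (real (s mod m) - x) + real m * real (s div m)"
    by (metis add.commute add_diff_eq diff_add_eq mod_mult_div_eq of_nat_add of_nat_mult)
  then show ?thesis by (simp only: cos_shift_period[OF assms])
qed

lemma cyc_kernel_sym: "cyc_kernel p m s t = cyc_kernel p m t s"
proof -
  have "cos (2 * pi * real k * (real s - real t) / real m) =
      cos (2 * pi * real k * (real t - real s) / real m)" for k
    by (subst cos_minus[symmetric]) (simp add: algebra_simps diff_divide_distrib)
  then show ?thesis by (simp add: cyc_kernel_def)
qed

text \<open>By \<open>cos (x + y) + cos (x - y) = 2 cos x cos y\<close> each mode is an eigenvector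
  of \<open>3 I + P + P'\<close> for \<open>gear_eig m k\<close>, which cancels one power in the
  denominator.\<close>

lemma cyc_kernel_step:
  assumes "m > 0"
  shows "3 * cyc_kernel (Suc p) m s t + cyc_kernel (Suc p) m (Suc s mod m) t
      + cyc_kernel (Suc p) m ((s + m - 1) mod m) t = cyc_kernel p m s t"
proof -
  have "3 * cos (2 * pi * real k * (real s - real t) / real m)
      + cos (2 * pi * real k * (real (Suc s mod m) - real t) / real m)
      + cos (2 * pi * real k * (real ((s + m - 1) mod m) - real t) / real m)
      = gear_eig m k * cos (2 * pi * real k * (real s - real t) / real m)" for k
  proof -
    define x y where "x = 2 * pi * real k * (real s - real t) / real m"
      and "y = 2 * pi * real k / real m"
    have 1: "2 * pi * real k * (real (Suc s) - real t) / real m = x + y"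
      unfolding x_def y_def by (simp add: add_divide_distrib[symmetric] algebra_simps)
    have "real (s + m - 1) - real t = (real s - 1 - real t) + real m * real 1"
      using assms by (simp add: of_nat_diff)
    moreover have 2: "2 * pi * real k * (real s - 1 - real t) / real m = x - y"
      unfolding x_def y_def by (simp add: diff_divide_distrib[symmetric] algebra_simps)
    ultimately show ?thesis
      unfolding cos_mod_period[OF assms] 1 gear_eig_def x_def[symmetric] y_def[symmetric]
      by (simp only: cos_shift_period[OF assms] 2) (simp add: cos_add cos_diff algebra_simps)
  qed
  note eq = this
  show ?thesis
    unfolding cyc_kernel_def sum_distrib_left sum.distrib[symmetric]
  proof (rule sum.cong[OF refl], goal_cases)
    case (1 k)
    have "3 * (c * a) + c * b + c * d = c * (3 * a + b + d)" for a b c d :: real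
      by (simp add: algebra_simps)
    then show ?case using gear_eig_pos[of m k] by (simp only: eq) (simp add: field_simps)
  qed
qed

section \<open>Cosine sums and the kernel as an inverse\<close>

lemma sum_cos_telescope:
  fixes x y :: real
  shows "2 * sin (y / 2) * (\<Sum>s<m. cos (x + real s * y)) = sin (x + real m * y - y / 2) - sin (x - y / 2)"
proof (induction m)
  case (Suc m)
  \<comment> \<open>Product to sum: each cosine becomes a difference of sines at neighbouring half
    steps, and these telescope.\<close>
  have "2 * sin (y / 2) * cos (x + real m * y) = sin (x + real m * y + y / 2) - sin (x + real m * y - y / 2)"
    by (simp add: sin_add sin_diff)
  moreover have "x + real (Suc m) * y - y / 2 = x + real m * y + y / 2" by (simp add: algebra_simps)
  ultimately show ?case using Suc by (simp only: sum.lessThan_Suc distrib_left)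
qed simp

text \<open>Each mode has \<open>0 < k < m\<close> and sums to zero over the cycle: the telescoped
  end terms differ by full turns, while \<open>sin (y / 2)\<close> is nonzero.\<close>

lemma sum_cyc_kernel:
  assumes "m > 0"
  shows "(\<Sum>s<m. cyc_kernel p m s t) = 0"
proof -
  have "(\<Sum>s<m. cos (2 * pi * real k * (real s - real t) / real m)) = 0"
    if k: "k \<in> {1..(m - 1) div 2}" for k
  proof -
    define y where "y = 2 * pi * real k / real m"
    have km: "0 < k" "k < m" using k by auto
    have "y / 2 < pi" using km by (simp add: y_def field_simps)
    moreover have "y / 2 > 0" using km by (simp add: y_def)
    ultimately have "sin (y / 2) > 0" by (intro sin_gt_zero)
    have "2 * pi * real k * (real s - real t) / real m = - real t * y + real s * y" for s
      using assms by (simp add: y_def field_simps)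
    moreover have "real m * y = 2 * real k * pi" using assms by (simp add: y_def)
    then have "sin (- real t * y + real m * y - y / 2) = sin (- real t * y - y / 2)"
      using sin_add[of "- real t * y - y / 2" "2 * real k * pi"]
      by (simp only: cos_2npi sin_2npi) (simp add: algebra_simps)
    ultimately show ?thesis
      using sum_cos_telescope[of y "- real t * y" m] \<open>sin (y / 2) > 0\<close> by simp
  qed
  note zero = this
  show ?thesis
    unfolding cyc_kernel_def
    by (subst sum.swap, rule sum.neutral, rule ballI) (simp only: sum_distrib_left[symmetric] zero mult_zero_right)
qed

text \<open>For odd \<open>m\<close> the modes \<open>k\<close> and \<open>m - k\<close> agree, so
  twice the half sum is the full Fourier sum without \<open>k = 0\<close>, which is the projection
  off the constants. The proof evaluates the half sum as a Dirichlet kernel.\<close>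

lemma cyc_kernel_0:
  assumes "odd m" "s < m" "t < m"
  shows "cyc_kernel 0 m s t = of_bool (s = t) - 1 / real m"
proof -
  define h where "h = (m - 1) div 2"
  have m: "m = 2 * h + 1" using assms by (auto simp: h_def elim!: oddE)
  have m0: "real m > 0" using assms by simp
  have K: "cyc_kernel 0 m s t = 2 / real m * (\<Sum>k = 1..h. cos (2 * pi * real k * (real s - real t) / real m))"
    by (simp add: cyc_kernel_def h_def sum_distrib_left)
  show ?thesis
  proof (cases "s = t")
    case True
    then show ?thesis unfolding K by (simp add: m field_simps)
  next
    case False
    define y where "y = 2 * pi * (real s - real t) / real m"
    have b: "\<bar>real s - real t\<bar> < real m" using assms by auto
    define d where "d = (real s - real t) / real m"
    have y2: "y / 2 = d * pi" by (simp add: y_def d_def)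
    \<comment> \<open>A zero would make \<open>s - t\<close> a multiple of \<open>m\<close>, but it
      is nonzero and smaller than \<open>m\<close> in absolute value.\<close>
    have "sin (y / 2) \<noteq> 0"
    proof
      assume "sin (y / 2) = 0"
      then obtain i :: int where i: "y / 2 = of_int i * pi" by (auto simp: sin_zero_iff_int2)
      then have "d = of_int i" unfolding y2 by simp
      then have "real s - real t = of_int i * real m" using m0 by (simp add: d_def field_simps)
      with b have "\<bar>of_int i\<bar> * real m < 1 * real m" by (simp add: abs_mult)
      then have "\<bar>of_int i\<bar> < (1 :: real)" using m0 by (subst (asm) mult_less_cancel_right_pos) auto
      then have "i = 0" by linarith
      with \<open>real s - real t = _\<close> False show False by simp
    qed
    have "(\<Sum>k = 1..h. cos (2 * pi * real k * (real s - real t) / real m)) = (\<Sum>k<h. cos (y + real k * y))"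
    proof -
      have "2 * pi * real (Suc k) * (real s - real t) / real m = y + real k * y" for k
        using m0 by (simp add: y_def field_simps)
      then show ?thesis by (simp only: One_nat_def sum.atLeast1_atMost_eq)
    qed
    \<comment> \<open>As \<open>m = 2 h + 1\<close>, the upper end of the telescoped sum is
      \<open>m (y / 2) = (s - t) pi\<close>; only the lower end survives.\<close>
    moreover have "sin (y + real h * y - y / 2) = 0"
    proof -
      have "y + real h * y - y / 2 = real m * (y / 2)" by (simp add: m field_simps)
      also have "\<dots> = of_int (int s - int t) * pi" using m0 by (simp add: y_def)
      finally show ?thesis unfolding sin_zero_iff_int2 by blast
    qed
    then have "2 * sin (y / 2) * (\<Sum>k<h. cos (y + real k * y)) = - sin (y / 2)"
      using sum_cos_telescope[of y y h] by simp
    then have "sin (y / 2) * (2 * (\<Sum>k<h. cos (y + real k * y)) + 1) = 0" by (simp add: distrib_left)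
    then have "2 * (\<Sum>k<h. cos (y + real k * y)) + 1 = 0"
      using \<open>sin (y / 2) \<noteq> 0\<close> unfolding mult_eq_0_iff by blast
    then have "(\<Sum>k<h. cos (y + real k * y)) = - 1 / 2" by linarith
    ultimately show ?thesis unfolding K using False by simp
  qed
qed

text \<open>The operator \<open>3 I + P + P'\<close> is symmetric, so it moves from \<open>z\<close>
  onto the kernel, where \<open>cyc_kernel_step\<close> lowers the power to zero.\<close>

lemma cyc_kernel_inverse:
  assumes "odd m" "s < m"
  shows "(\<Sum>t<m. cyc_kernel 1 m s t * (3 * z t + z (Suc t mod m) + z ((t + m - 1) mod m))) =
    z s - (\<Sum>t<m. z t) / real m"
proof -
  have m: "m > 0" using assms by simp
  let ?R = "cyc_kernel 1 m s"
  have "(\<Sum>t<m. ?R t * (3 * z t + z (Suc t mod m) + z ((t + m - 1) mod m))) =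
      (\<Sum>t<m. 3 * ?R t * z t) + (\<Sum>t<m. ?R t * z (Suc t mod m)) + (\<Sum>t<m. z ((t + m - 1) mod m) * ?R t)"
    by (simp add: sum.distrib[symmetric] algebra_simps)
  also have "\<dots> = (\<Sum>t<m. (3 * ?R t + ?R (Suc t mod m) + ?R ((t + m - 1) mod m)) * z t)"
    unfolding sum_cyc_succ[OF m, of ?R z] sum_cyc_succ[OF m, of z ?R, symmetric]
    by (simp add: sum.distrib[symmetric] algebra_simps)
  also have "\<dots> = (\<Sum>t<m. (of_bool (s = t) - 1 / real m) * z t)"
    using cyc_kernel_step[OF m, of 0 _ s] cyc_kernel_0[OF assms(1) _ assms(2)]
    by (intro sum.cong refl) (auto simp: cyc_kernel_sym[of _ m s])
  also have "\<dots> = z s - (\<Sum>t<m. z t) / real m"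
    using assms(2) by (simp add: left_diff_distrib sum_subtractf sum_divide_distrib
        of_bool_def if_distrib[where f = "\<lambda>x. x * _"] cong: if_cong)
  finally show ?thesis .
qed

section \<open>Inner products with vectors of the form \<open>b 1 + c a + K z\<close>\<close>

lemma sum_rotate:
  "(\<Sum>l\<in>A. \<Sum>s\<in>B. \<Sum>t\<in>C. f l s t) = (\<Sum>s\<in>B. \<Sum>t\<in>C. \<Sum>l\<in>A. f l s t)"
  by (subst sum.swap, rule sum.cong[OF refl], rule sum.swap)

text \<open>Pairs \<open>x\<close> with \<open>1\<close>, \<open>a\<close> and the columns of
  \<open>K\<close>. Only Gram data enter: \<open>1'1 = 2m + 1\<close>, \<open>1'a = 3m\<close>,
  \<open>a'a = 5m\<close>, the matrix \<open>K'K\<close>, and the constant vectors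
  \<open>K'1\<close> and \<open>K'a\<close> with entries 3 and 5.\<close>

lemma sum_gear_combination:
  assumes x: "\<forall>l<2*m+1. x l = b + c * gear_wt m l + (\<Sum>s<m. gear_pt m l s * z s)"
  shows "(\<Sum>l<2*m+1. x l) = (2 * real m + 1) * b + 3 * real m * c + 3 * (\<Sum>s<m. z s)"
    and "(\<Sum>l<2*m+1. gear_wt m l * x l) = 3 * real m * b + 5 * real m * c + 5 * (\<Sum>s<m. z s)"
    and "t < m \<Longrightarrow> (\<Sum>l<2*m+1. gear_pt m l t * x l) =
      3 * b + 5 * c + (3 * z t + z (Suc t mod m) + z ((t + m - 1) mod m))"
proof -
  have lin: "(\<Sum>l<2*m+1. f l * x l) = b * (\<Sum>l<2*m+1. f l) + c * (\<Sum>l<2*m+1. f l * gear_wt m l)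
      + (\<Sum>l<2*m+1. f l * (\<Sum>s<m. gear_pt m l s * z s))" for f
    unfolding sum_distrib_left[of b] sum_distrib_left[of c] sum.distrib[symmetric]
    by (intro sum.cong refl) (auto simp: x algebra_simps)
  have swap: "(\<Sum>l<2*m+1. f l * (\<Sum>s<m. gear_pt m l s * z s)) =
      (\<Sum>s<m. (\<Sum>l<2*m+1. gear_pt m l s * f l) * z s)" for f
    unfolding sum_distrib_left sum_distrib_right
    by (subst sum.swap) (intro sum.cong refl, simp)
  have "(\<Sum>l<2*m+1. gear_pt m l s * 1) = 3" if "s < m" for s using sum_gear_pt[OF that] by simp
  then have "(\<Sum>s<m. (\<Sum>l<2*m+1. gear_pt m l s * 1) * z s) = 3 * (\<Sum>s<m. z s)"
    by (simp only: sum_distrib_left) (intro sum.cong refl, simp only: lessThan_iff)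
  then show "(\<Sum>l<2*m+1. x l) = (2 * real m + 1) * b + 3 * real m * c + 3 * (\<Sum>s<m. z s)"
    using lin[of "\<lambda>_. 1"] swap[of "\<lambda>_. 1"] unfolding mult_1 sum_gear_wt by simp
  have "(\<Sum>s<m. (\<Sum>l<2*m+1. gear_pt m l s * gear_wt m l) * z s) = 5 * (\<Sum>s<m. z s)"
    using sum_gear_pt_wt[of _ m]
    by (simp only: sum_distrib_left) (intro sum.cong refl, simp only: lessThan_iff)
  then show "(\<Sum>l<2*m+1. gear_wt m l * x l) = 3 * real m * b + 5 * real m * c + 5 * (\<Sum>s<m. z s)"
    using lin[of "gear_wt m"] swap[of "gear_wt m"] unfolding sum_gear_wt sum_gear_wt_square by simp
  show "(\<Sum>l<2*m+1. gear_pt m l t * x l) =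
      3 * b + 5 * c + (3 * z t + z (Suc t mod m) + z ((t + m - 1) mod m))" if "t < m"
    unfolding lin[of "\<lambda>l. gear_pt m l t"] gear_pt_gram[OF that] sum_gear_pt[OF that] sum_gear_pt_wt[OF that]
    by simp
qed

section \<open>The projection onto the range of the distance matrix\<close>

text \<open>The first summand projects onto the span of the all-ones and the weight vector: its
  coefficients form the inverse of their Gram matrix with rows \<open>(2m+1, 3m)\<close> and \<open>(3m, 5m)\<close>. The
  second one projects onto the image under \<open>gear_pt\<close> of the vectors of coordinate sum zero, which is
  orthogonal to that span.\<close>

definition gear_proj :: "nat \<Rightarrow> nat \<Rightarrow> nat \<Rightarrow> real" where
  "gear_proj m i j =
     (5 - 3 * (gear_wt m i + gear_wt m j) + (2 * real m + 1) / real m * gear_wt m i * gear_wt m j)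
       / (real m + 5)
     + (\<Sum>s<m. gear_pt m i s * (\<Sum>t<m. cyc_kernel 1 m s t * gear_pt m j t))"

lemma sum_sum_kernel_sym:
  fixes f g :: "nat \<Rightarrow> real"
  shows "(\<Sum>s<m. f s * (\<Sum>t<m. cyc_kernel p m s t * g t)) =
    (\<Sum>s<m. g s * (\<Sum>t<m. cyc_kernel p m s t * f t))"
  unfolding sum_distrib_left
  by (subst sum.swap) (intro sum.cong refl, simp add: cyc_kernel_sym[of p m] mult_ac)

lemma gear_proj_sym: "gear_proj m i j = gear_proj m j i"
  unfolding gear_proj_def by (subst sum_sum_kernel_sym) (simp add: algebra_simps)

text \<open>The kernel part sends \<open>x\<close> to \<open>K z\<close> minus \<open>Z / m\<close>
  times the weight vector, since \<open>K 1 = a\<close>; the other summand returns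
  \<open>b 1 + c a\<close> plus exactly the missing multiple.\<close>

lemma gear_proj_fixes:
  assumes "odd m" and i: "i < 2*m+1"
    and x: "\<forall>l<2*m+1. x l = b + c * gear_wt m l + (\<Sum>s<m. gear_pt m l s * z s)"
  shows "(\<Sum>l<2*m+1. gear_proj m i l * x l) = x i"
proof -
  have m: "m > 0" using assms(1) by (cases m) auto
  define Z where "Z = (\<Sum>s<m. z s)"
  define w where "w = gear_wt m i"
  note sums = sum_gear_combination[of m x b c z, OF x, folded Z_def]
  have R0: "(\<Sum>t<m. cyc_kernel 1 m s t) = 0" for s
    using sum_cyc_kernel[OF m, of 1 s] unfolding cyc_kernel_sym[of 1 m s] .
  have "(\<Sum>l<2*m+1. (\<Sum>s<m. gear_pt m i s * (\<Sum>t<m. cyc_kernel 1 m s t * gear_pt m l t)) * x l) =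
      (\<Sum>s<m. gear_pt m i s * (\<Sum>t<m. cyc_kernel 1 m s t * (\<Sum>l<2*m+1. gear_pt m l t * x l)))"
    unfolding sum_distrib_left sum_distrib_right
    by (subst sum_rotate, intro sum.cong refl) (simp add: mult_ac)
  also have "\<dots> = (\<Sum>s<m. gear_pt m i s * (z s - Z / real m))"
  proof (intro sum.cong refl arg_cong2[where f = "(*)"])
    fix s assume "s \<in> {..<m}"
    then have s: "s < m" by simp
    have "(\<Sum>t<m. cyc_kernel 1 m s t * (\<Sum>l<2*m+1. gear_pt m l t * x l)) =
        (\<Sum>t<m. cyc_kernel 1 m s t * (3 * b + 5 * c)
           + cyc_kernel 1 m s t * (3 * z t + z (Suc t mod m) + z ((t + m - 1) mod m)))"
      using sums(3) by (intro sum.cong refl) (simp only: lessThan_iff distrib_left)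
    also have "\<dots> = z s - Z / real m"
      unfolding sum.distrib sum_distrib_right[symmetric] R0 cyc_kernel_inverse[OF assms(1) s] Z_def by simp
    finally show "(\<Sum>t<m. cyc_kernel 1 m s t * (\<Sum>l<2*m+1. gear_pt m l t * x l)) = z s - Z / real m" .
  qed
  also have "\<dots> = (\<Sum>s<m. gear_pt m i s * z s) - w * Z / real m"
    unfolding w_def gear_wt_eq_sum[OF i m]
    by (simp add: right_diff_distrib sum_subtractf sum_distrib_right sum_divide_distrib)
  finally have 1: "(\<Sum>l<2*m+1. (\<Sum>s<m. gear_pt m i s * (\<Sum>t<m. cyc_kernel 1 m s t * gear_pt m l t)) * x l) =
      (\<Sum>s<m. gear_pt m i s * z s) - w * Z / real m" .
  \<comment> \<open>In row \<open>i\<close> the first summand of \<open>gear_proj\<close> is affine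
    in the weight of the column, with these coefficients.\<close>
  define p q where "p = (5 - 3 * w) / (real m + 5)"
    and "q = ((2 * real m + 1) / real m * w - 3) / (real m + 5)"
  have "(\<Sum>l<2*m+1. gear_proj m i l * x l) = p * (\<Sum>l<2*m+1. x l) + q * (\<Sum>l<2*m+1. gear_wt m l * x l)
     + (\<Sum>l<2*m+1. (\<Sum>s<m. gear_pt m i s * (\<Sum>t<m. cyc_kernel 1 m s t * gear_pt m l t)) * x l)"
    unfolding sum_distrib_left[of p] sum_distrib_left[of q] sum.distrib[symmetric]
  proof (intro sum.cong refl, goal_cases)
    case (1 l)
    have "(5 - 3 * (w + gear_wt m l) + (2 * real m + 1) / real m * w * gear_wt m l) / (real m + 5)
       = p + q * gear_wt m l"
      unfolding p_def q_def by (simp add: add_divide_distrib[symmetric] algebra_simps)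
    then show ?case unfolding gear_proj_def w_def[symmetric] by (simp add: algebra_simps)
  qed
  also have "\<dots> = b + c * w + (\<Sum>s<m. gear_pt m i s * z s)"
    unfolding 1 sums(1,2) p_def q_def using m
    by (simp add: divide_simps) (simp add: algebra_simps)
  finally show ?thesis using x i by (simp add: w_def)
qed

section \<open>Entries of the claimed inverse\<close>

lemma C_mat_index:
  assumes m: "m = n - 1" and ij: "i < m" "j < m"
  shows "C_mat n k $$ (i, j) = cos (2 * pi * real k * (real i - real j) / real m)"
proof -
  define as where "as = 1 # map (\<lambda>j. cos (2 * pi * real j * real k / real m)) [1..<m]"
  have mr: "real n - 1 = real m" and m0: "m > 0" using m ij by auto
  have len: "length as = m" using ij by (simp add: as_def)
  have nth: "as ! l = cos (2 * pi * real k * real l / real m)" if "l < m" for l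
  proof (cases l)
    case (Suc q)
    then have "[1..<m] ! q = l" "q < length [1..<m]" using that by (auto simp: nth_upt)
    then show ?thesis by (simp add: as_def Suc mult_ac)
  qed (simp add: as_def)
  define l where "l = (if i \<le> j then j - i else j + m - i)"
  have l: "l < m" using ij by (auto simp: l_def)
  \<comment> \<open>Below the diagonal the circulant index wraps around by \<open>m\<close>, a full
    period.\<close>
  have "real l = - (real i - real j) + real m * real (if i \<le> j then 0 else 1)"
    using ij by (auto simp: l_def)
  then have "as ! l = cos (2 * pi * real k * - (real i - real j) / real m)"
    unfolding nth[OF l] by (simp only: cos_shift_period[OF m0])
  moreover have "C_mat n k $$ (i, j) = as ! l"
    unfolding C_mat_def mr m[symmetric] as_def[symmetric] using circ_index[of i as j] ij by (simp add: len l_def)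
  ultimately show ?thesis
    by (simp only: mult_minus_right minus_divide_left[symmetric] cos_minus)
qed

text \<open>The first row starts one step later than that of \<open>C_mat\<close>, hence
  \<open>Suc j\<close>; its last entry 1 is the cosine after a whole number of turns.\<close>

lemma C_tilde_index:
  assumes m: "m = n - 1" and ij: "i < m" "j < m"
  shows "C_tilde n k $$ (i, j) = cos (2 * pi * real k * (real i - real (Suc j)) / real m)"
proof -
  define as where "as = map (\<lambda>j. cos (2 * pi * real j * real k / real m)) [1..<m] @ [1]"
  have mr: "real n - 1 = real m" and m0: "m > 0" using m ij by auto
  have len: "length as = m" using ij by (simp add: as_def)
  have nth: "as ! l = cos (2 * pi * real k * real (Suc l) / real m)" if "l < m" for l
  proof (cases "Suc l = m")
    case True
    then have "as ! l = 1" by (auto simp: as_def nth_append)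
    moreover have "2 * pi * real k * real (Suc l) / real m = 2 * real k * pi" 
      using m0 unfolding True by simp
    ultimately show ?thesis by (simp only: cos_2npi)
  next
    case False
    then have "l < m - 1" using that by simp
    then show ?thesis by (simp add: as_def nth_append mult_ac)
  qed
  define l where "l = (if i \<le> j then j - i else j + m - i)"
  have l: "l < m" using ij by (auto simp: l_def)
  have "real (Suc l) = - (real i - real (Suc j)) + real m * real (if i \<le> j then 0 else 1)"
    using ij by (auto simp: l_def)
  then have "as ! l = cos (2 * pi * real k * - (real i - real (Suc j)) / real m)"
    unfolding nth[OF l] by (simp only: cos_shift_period[OF m0])
  moreover have "C_tilde n k $$ (i, j) = as ! l"
    unfolding C_tilde_def mr m[symmetric] as_def[symmetric] using circ_index[of i as j] ij by (simp add: len l_def)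
  ultimately show ?thesis
    by (simp only: mult_minus_right minus_divide_left[symmetric] cos_minus)
qed

lemma gear_phi_pos:
  assumes "k \<in> {1..(m - 1) div 2}" "m = n - 1"
  shows "gear_phi n k > 0"
proof -
  have "2 * k < m" "m > 0" "real n - 1 = real m" using assms by auto
  then have "pi * real k / (real n - 1) < pi / 2" by (simp add: field_simps)
  moreover have "pi * real k / (real n - 1) \<ge> 0" using \<open>real n - 1 = real m\<close> by simp
  ultimately show ?thesis unfolding gear_phi_def using pi_gt_zero by (intro cos_gt_zero_pi) linarith+
qed

lemma gear_eig_phi:
  assumes "m > 0" "m = n - 1"
  shows "gear_eig m k = 1 + 4 * (gear_phi n k)\<^sup>2"
proof -
  have "real n - 1 = real m" using assms by auto
  then have "2 * pi * real k / real m = 2 * (pi * real k / (real n - 1))" by simp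
  then show ?thesis unfolding gear_eig_def gear_phi_def by (simp only: cos_double_cos) simp
qed

text \<open>For the cosine matrix \<open>C\<close> of mode \<open>k\<close>, an entry of
  \<open>K C K'\<close> has one cosine for two rim vertices (\<open>C_mat\<close>), two for a mixed
  pair (\<open>C_mat\<close> plus \<open>C_tilde\<close> or its transpose) and four for two inserted
  vertices. The four collapse to \<open>4 (gear_phi n k)^2\<close> times one cosine, which explains
  why the last block lacks the denominator of the others.\<close>

lemma B_mat_index:
  assumes m: "m = n - 1" "m > 0" and k: "k \<in> {1..(m - 1) div 2}"
    and ij: "i < 2*m+1" "j < 2*m+1"
  shows "B_mat n k $$ (i, j) = 2 / (real m * gear_eig m k ^ 2) * (\<Sum>s<m. gear_pt m i s *
    (\<Sum>t<m. cos (2 * pi * real k * (real s - real t) / real m) * gear_pt m j t))"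
proof -
  define f where "f = gear_phi n k"
  have f: "f > 0" using gear_phi_pos[OF k m(1)] by (simp add: f_def)
  have mr: "real n - 1 = real m" using m by auto
  define co where "co = (\<lambda>s t. cos (2 * pi * real k * (s - t) / real m))"
  have co: "cos (2 * pi * real k * (s - t) / real m) = co s t" for s t by (simp add: co_def)
  have inner: "(\<Sum>t<m. co (real s) (real t) * gear_pt m j t) =
      (if j = 0 then 0 else if j \<le> m then co s (real (j - 1))
       else co s (real (j - 1 - m)) + co s (real (Suc (j - 1 - m))))" for s :: nat
  proof -
    have "(\<Sum>t<m. co (real s) (real t) * gear_pt m j t) = (\<Sum>t<m. gear_pt m j t * co s t)"
      by (simp add: mult.commute)
    moreover have "co s (real (r mod m)) = co s (real r)" for r
    proof -
      have "co s (real q) = cos (2 * pi * real k * (real q - real s) / real m)" for q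
        unfolding co_def by (subst cos_minus[symmetric]) (simp add: algebra_simps diff_divide_distrib)
      then show ?thesis by (simp only: cos_mod_period[OF m(2)])
    qed
    ultimately show ?thesis using gear_pt_apply[OF ij(2) m(2), of "\<lambda>t. co s t"] by simp
  qed
  have com: "co (real (r mod m)) x = co (real r) x" for r x
    unfolding co_def by (rule cos_mod_period[OF m(2)])
  have co2: "co (real (Suc a)) (real b) + co (real a) (real (Suc b)) = (4 * f\<^sup>2 - 2) * co (real a) (real b)"
    "co (real (Suc a)) (real (Suc b)) = co (real a) (real b)" for a b
  proof -
    define x y where "x = 2 * pi * real k * (real a - real b) / real m" and "y = 2 * pi * real k / real m"
    have "2 * pi * real k * (real (Suc a) - real b) / real m = x + y"
      "2 * pi * real k * (real a - real (Suc b)) / real m = x - y"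
      unfolding x_def y_def by (simp_all add: add_divide_distrib[symmetric] diff_divide_distrib[symmetric] algebra_simps)
    moreover have "4 * f\<^sup>2 - 2 = 2 * cos y"
      using gear_eig_phi[OF m(2,1), of k] by (simp add: f_def gear_eig_def y_def)
    ultimately show "co (real (Suc a)) (real b) + co (real a) (real (Suc b)) = (4 * f\<^sup>2 - 2) * co (real a) (real b)"
      unfolding co_def x_def[symmetric] by (simp add: cos_add cos_diff)
  qed (simp add: co_def)
  have C: "C_mat n k \<in> carrier_mat m m" "C_tilde n k \<in> carrier_mat m m"
    using m by (auto simp: C_mat_def C_tilde_def intro!: carrier_matI)
  have Ci: "C_mat n k $$ (a, b) = co a b" "C_tilde n k $$ (a, b) = co a (Suc b)" if "a < m" "b < m" for a b
    using C_mat_index[OF m(1) that] C_tilde_index[OF m(1) that] by (simp_all add: co_def)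
  define g where "g = 2 / (real m * (2 * f + 1 / (2 * f))\<^sup>2)"
  have lam: "2 / (real m * gear_eig m k ^ 2) = g * (1 / (4 * f\<^sup>2))"
  proof -
    have "(2 * f + 1 / (2 * f)) = gear_eig m k / (2 * f)"
      using f gear_eig_phi[OF m(2,1), of k] by (simp add: f_def[symmetric] field_simps power2_eq_square)
    then show ?thesis using f by (simp add: g_def power_divide power_mult_distrib)
  qed
  have sym: "co x y = co y x" for x y
    unfolding co_def by (subst cos_minus[symmetric]) (simp add: algebra_simps diff_divide_distrib)
  have "B_mat n k $$ (i, j) = g *
    (if i = 0 \<or> j = 0 then 0
     else if i \<le> m then
       (if j \<le> m then 1 / (4 * f\<^sup>2) * co (real (i-1)) (real (j-1))
        else 1 / (4 * f\<^sup>2) * (co (real (i-1)) (real (j-1-m)) + co (real (i-1)) (real (Suc (j-1-m)))))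
     else
       (if j \<le> m then 1 / (4 * f\<^sup>2) * (co (real (i-1-m)) (real (j-1)) + co (real (j-1)) (real (Suc (i-1-m))))
        else co (real (i-1-m)) (real (j-1-m))))"
  proof -
    have "i - 1 < m" if "i \<noteq> 0" "i \<le> m" using that by auto
    moreover have "i - 1 - m < m" if "\<not> i \<le> m" using that ij by auto
    moreover have "j - 1 < m" if "j \<noteq> 0" "j \<le> m" using that by auto
    moreover have "j - 1 - m < m" if "\<not> j \<le> m" using that ij by auto
    ultimately show ?thesis
      unfolding B_mat_def Let_def f_def[symmetric] mr g_def[symmetric] m(1)[symmetric]
      using C ij m(2)
      by (subst index_smult_mat, simp, simp, subst block3_index[where m = m]) (auto simp: Ci)
  qed
  moreover have "(\<Sum>s<m. gear_pt m i s * (\<Sum>t<m. co (real s) (real t) * gear_pt m j t)) =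
     (if i = 0 \<or> j = 0 then 0
     else if i \<le> m then
       (if j \<le> m then co (real (i-1)) (real (j-1))
        else (co (real (i-1)) (real (j-1-m)) + co (real (i-1)) (real (Suc (j-1-m)))))
     else
       (if j \<le> m then (co (real (i-1-m)) (real (j-1)) + co (real (j-1)) (real (Suc (i-1-m))))
        else 4 * f\<^sup>2 * co (real (i-1-m)) (real (j-1-m))))"
  proof -
    have "co (real (i-1-m)) (real (j-1-m)) + co (real (i-1-m)) (real (Suc (j-1-m)))
        + (co (real (Suc (i-1-m))) (real (j-1-m)) + co (real (Suc (i-1-m))) (real (Suc (j-1-m)))) =
        4 * f\<^sup>2 * co (real (i-1-m)) (real (j-1-m))"
      using co2[of "i-1-m" "j-1-m"] by (simp only: algebra_simps)
    then show ?thesis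
      unfolding inner gear_pt_apply[OF ij(1) m(2)] com sym[of "real (j-1)" "real (Suc _)"]
      by (simp del: of_nat_diff of_nat_Suc)
  qed
  ultimately show ?thesis
    unfolding co lam using f by simp
qed

lemma B_mat_sum_index:
  assumes m: "m = n - 1" "m > 0" and ij: "i < 2*m+1" "j < 2*m+1"
  shows "(\<Sum>k = 1..(m - 1) div 2. B_mat n k $$ (i, j)) =
    (\<Sum>s<m. gear_pt m i s * (\<Sum>t<m. cyc_kernel 2 m s t * gear_pt m j t))"
proof -
  have "(\<Sum>k = 1..(m - 1) div 2. B_mat n k $$ (i, j)) = (\<Sum>k = 1..(m - 1) div 2.
     2 / (real m * gear_eig m k ^ 2) * (\<Sum>s<m. gear_pt m i s *
    (\<Sum>t<m. cos (2 * pi * real k * (real s - real t) / real m) * gear_pt m j t)))"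
    using B_mat_index[OF m _ ij] by (intro sum.cong refl) auto
  also have "\<dots> = (\<Sum>s<m. gear_pt m i s * (\<Sum>t<m. cyc_kernel 2 m s t * gear_pt m j t))"
    unfolding cyc_kernel_def sum_distrib_left sum_distrib_right
    by (subst sum_rotate, intro sum.cong refl) (simp add: mult_ac)
  finally show ?thesis .
qed

text \<open>Up to a factor \<open>A_mat\<close> is the outer product of this vector with itself; it
  is the combination of \<open>1\<close> and \<open>a\<close> with hub entry 1 and coordinate sum
  zero.\<close>

definition gear_v :: "nat \<Rightarrow> nat \<Rightarrow> real" where
  "gear_v m i = 1 - (2 * real m + 1) / (3 * real m) * gear_wt m i"

text \<open>The three values of \<open>u_vec\<close> are affine in the weight, so it is a
  combination of \<open>1\<close> and \<open>a\<close>. \<open>D\<close> maps it to the all-ones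
  vector, and \<open>m / 2\<close> in the formula is the reciprocal of its coordinate sum.\<close>

definition gear_u :: "nat \<Rightarrow> nat \<Rightarrow> real" where
  "gear_u m i = ((2 * real m - 5) * gear_wt m i - (3 * real m - 10)) / (real m * (real m + 5))"

lemma A_mat_index:
  assumes m: "m = n - 1" "m > 0" and ij: "i < 2*m+1" "j < 2*m+1"
  shows "A_mat n $$ (i, j) = 9 * real m / (real m + 5)\<^sup>2 * gear_v m i * gear_v m j"
proof -
  have n: "real n = real m + 1" using m by auto
  define p q where "p = (real m - 1) / (3 * real m)" and "q = - (real m + 2) / (3 * real m)"
  have v: "gear_v m l = (if l = 0 then 1 else if l \<le> m then p else q)" for l
    using m(2) by (auto simp: gear_v_def gear_wt_def p_def q_def field_simps)
  have pq: "(real m + 1 - 2) / (3 * real m) = p" "- (real m + 1 + 1) / (3 * real m) = q"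
    "(real m + 1 - 2)\<^sup>2 / (9 * (real m)\<^sup>2) = p\<^sup>2" "(real m + 1 + 1)\<^sup>2 / (9 * (real m)\<^sup>2) = q\<^sup>2"
    "- ((real m + 1 - 2) * (real m + 1 + 1)) / (9 * (real m)\<^sup>2) = p * q"
    using m(2) by (simp_all add: p_def q_def power2_eq_square divide_simps, simp_all add: algebra_simps)
  have "i - 1 < m" if "i \<noteq> 0" "i \<le> m" using that by auto
  moreover have "i - 1 - m < m" if "\<not> i \<le> m" using that ij by auto
  moreover have "j - 1 < m" if "j \<noteq> 0" "j \<le> m" using that by auto
  moreover have "j - 1 - m < m" if "\<not> j \<le> m" using that ij by auto
  moreover have n': "real m + 1 - 1 = real m" "real m + 1 + 4 = real m + 5" by simp_all
  ultimately show ?thesis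
    unfolding A_mat_def Let_def m(1)[symmetric] J_mat_alt v n n' pq using ij
    by (subst index_smult_mat, simp add: all_ones_def, simp add: all_ones_def, subst block3_index[where m = m])
       (auto simp: all_ones_def power2_eq_square)
qed

lemma u_vec_index:
  assumes m: "m = n - 1" "m > 0" and i: "i < 2*m+1"
  shows "u_vec n $$ (i, 0) = gear_u m i"
proof -
  have n: "real n = real m + 1" using m by auto
  have q: "(real n)\<^sup>2 + 3 * real n - 4 = real m * (real m + 5)"
    unfolding n by (simp add: power2_eq_square algebra_simps)
  have u: "gear_u m l = (if l = 0 then - (3 * real n - 13) / (real m * (real m + 5))
      else if l \<le> m then - (real n - 6) / (real m * (real m + 5)) else 1 / (real n + 4))" for l
    using m(2) unfolding gear_u_def gear_wt_def n by (auto simp: divide_simps) (simp add: algebra_simps)?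
  show ?thesis
    unfolding u_vec_def Let_def q m(1)[symmetric] u using i
    by (auto simp: append_rows_def all_ones_def)
qed

section \<open>The claimed inverse entrywise and its product with \<open>D\<close>\<close>

definition gear_X :: "nat \<Rightarrow> nat \<Rightarrow> nat \<Rightarrow> real" where
  "gear_X m i j = real m / 2 * gear_u m i * gear_u m j
     - 9 * real m / (real m + 5)\<^sup>2 / 2 * gear_v m i * gear_v m j
     - 1 / 2 * (\<Sum>s<m. gear_pt m i s * (\<Sum>t<m. cyc_kernel 2 m s t * gear_pt m j t))"

lemma gear_X_sym: "gear_X m i j = gear_X m j i"
  unfolding gear_X_def by (subst sum_sum_kernel_sym) (simp add: mult_ac)

lemma inverse_formula_eq:
  assumes "n \<ge> 4" "even n" and m: "m = n - 1"
  shows "(- 1 / 2) \<cdot>\<^sub>m L_even n + ((real n - 1) / 2) \<cdot>\<^sub>m (u_vec n * transpose_mat (u_vec n))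
    = mat (2*m+1) (2*m+1) (\<lambda>(i, j). gear_X m i j)"
proof -
  have m0: "m > 0" and mr: "real n - 1 = real m" and d: "2*n-1 = 2*m+1" and h: "(n - 2) div 2 = (m - 1) div 2"
    using assms by auto
  have u: "u_vec n \<in> carrier_mat (2*m+1) 1"
    unfolding u_vec_def Let_def m[symmetric] by (auto simp: all_ones_def append_rows_def)
  have A: "A_mat n \<in> carrier_mat (2*m+1) (2*m+1)"
    unfolding A_mat_def Let_def m[symmetric] J_mat_alt by (auto simp: all_ones_def intro!: carrier_matI)
  have L: "L_even n \<in> carrier_mat (2*m+1) (2*m+1)" using A unfolding L_even_def d by auto
  show ?thesis
  proof (rule eq_matI, goal_cases)
    case (1 i j)
    then have ij: "i < 2*m+1" "j < 2*m+1" by simp_all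
    have "(u_vec n * transpose_mat (u_vec n)) $$ (i, j) = gear_u m i * gear_u m j"
      using u ij u_vec_index[OF m m0] by (simp add: scalar_prod_def)
    moreover have "L_even n $$ (i, j) = A_mat n $$ (i, j) + (\<Sum>k = 1..(m - 1) div 2. B_mat n k $$ (i, j))"
      using A ij unfolding L_even_def d h by simp
    ultimately show ?case
      using ij u L B_mat_sum_index[OF m m0 ij] A_mat_index[OF m m0 ij] mr
      by (simp add: gear_X_def algebra_simps)
  qed (use u L in auto)
qed

text \<open>Puts a column of the claimed inverse into the form \<open>b 1 + c a + K z\<close> that
  \<open>sum_gear_combination\<close> and \<open>gear_proj_fixes\<close> ask for.\<close>

lemma gear_X_column:
  fixes m l j :: nat
  defines "\<kappa> \<equiv> (2 * real m + 1) / (3 * real m)"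
    and "\<alpha> \<equiv> 9 * real m / (real m + 5)\<^sup>2 / 2"
    and "u0 \<equiv> - (3 * real m - 10) / (real m * (real m + 5))"
    and "u1 \<equiv> (2 * real m - 5) / (real m * (real m + 5))"
  shows "gear_X m l j = (real m / 2 * gear_u m j * u0 - \<alpha> * gear_v m j)
    + (real m / 2 * gear_u m j * u1 + \<alpha> * gear_v m j * \<kappa>) * gear_wt m l
    + (\<Sum>s<m. gear_pt m l s * (- 1 / 2 * (\<Sum>t<m. cyc_kernel 2 m s t * gear_pt m j t)))"
proof -
  have u: "gear_u m l = u0 + u1 * gear_wt m l"
    unfolding gear_u_def u0_def u1_def by (simp add: add_divide_distrib[symmetric] algebra_simps)
  have v: "gear_v m l = 1 - \<kappa> * gear_wt m l" unfolding gear_v_def \<kappa>_def ..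
  have z: "(\<Sum>s<m. gear_pt m l s * (- 1 / 2 * y s)) = - 1 / 2 * (\<Sum>s<m. gear_pt m l s * y s)" for y
    unfolding sum_distrib_left by (intro sum.cong refl) simp
  have \<alpha>: "9 * real m / (real m + 5)\<^sup>2 / 2 = \<alpha>" by (simp add: \<alpha>_def)
  show ?thesis unfolding gear_X_def z u v \<alpha> by (simp add: algebra_simps)
qed

lemma gear_D_times_X:
  assumes "n \<ge> 4" and m: "m = n - 1" and i: "i < 2*m+1"
  shows "(\<Sum>l<2*m+1. gear_D n $$ (i, l) * gear_X m l j) = gear_proj m i j"
proof -
  have m0: "m > 0" using assms by simp
  define w where "w = gear_wt m i"
  define y where "y = (\<lambda>s. \<Sum>t<m. cyc_kernel 2 m s t * gear_pt m j t)"
  define z where "z = (\<lambda>s. - 1 / 2 * y s)"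
  \<comment> \<open>Opaque names keep these coefficients folded until the closing rational
    identity.\<close>
  obtain b c where b: "b = real m / 2 * gear_u m j * (- (3 * real m - 10) / (real m * (real m + 5)))
      - 9 * real m / (real m + 5)\<^sup>2 / 2 * gear_v m j"
    and c: "c = real m / 2 * gear_u m j * ((2 * real m - 5) / (real m * (real m + 5)))
      + 9 * real m / (real m + 5)\<^sup>2 / 2 * gear_v m j * ((2 * real m + 1) / (3 * real m))"
    by blast
  have x: "gear_X m l j = b + c * gear_wt m l + (\<Sum>s<m. gear_pt m l s * z s)" for l
    unfolding z_def y_def b c by (rule gear_X_column)
  \<comment> \<open>The kernel annihilates constants, so \<open>z\<close> drops out of the pairings
    with \<open>1\<close> and \<open>a\<close>.\<close>
  have "(\<Sum>s<m. y s) = 0"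
    unfolding y_def by (subst sum.swap) (simp add: sum_distrib_right[symmetric] sum_cyc_kernel[OF m0])
  then have Z: "(\<Sum>s<m. z s) = 0" unfolding z_def by (simp add: sum_divide_distrib[symmetric] sum_negf)
  have "\<forall>l<2*m+1. gear_X m l j = b + c * gear_wt m l + (\<Sum>s<m. gear_pt m l s * z s)" using x by blast
  note sums = sum_gear_combination[OF this, unfolded Z]
  \<comment> \<open>The Gram operator lowers the inverse square to the inverse; the remaining
    \<open>- 1 / 2\<close> cancels against the factor \<open>- 2\<close> in
    \<open>D\<close>.\<close>
  have Nz: "3 * z s + z (Suc s mod m) + z ((s + m - 1) mod m) =
      - 1 / 2 * (\<Sum>t<m. cyc_kernel 1 m s t * gear_pt m j t)" for s
  proof -
    have "3 * y s + y (Suc s mod m) + y ((s + m - 1) mod m) = (\<Sum>t<m. cyc_kernel 1 m s t * gear_pt m j t)"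
      unfolding y_def cyc_kernel_step[OF m0, of 1 s, symmetric] sum_distrib_left sum.distrib[symmetric]
      by (intro sum.cong refl) (simp add: algebra_simps numeral_2_eq_2)
    then show ?thesis by (simp add: z_def)
  qed
  have "(\<Sum>l<2*m+1. gear_D n $$ (i, l) * gear_X m l j) =
     (\<Sum>l<2*m+1. w * gear_X m l j + gear_wt m l * gear_X m l j
        - 2 * ((\<Sum>s<m. gear_pt m i s * gear_pt m l s) * gear_X m l j))"
    by (intro sum.cong refl)
      (simp only: lessThan_iff gear_D_index[OF assms(1) m i] w_def left_diff_distrib distrib_right mult.assoc)
  also have "\<dots> = w * (\<Sum>l<2*m+1. gear_X m l j) + (\<Sum>l<2*m+1. gear_wt m l * gear_X m l j)
     - 2 * (\<Sum>l<2*m+1. (\<Sum>s<m. gear_pt m i s * gear_pt m l s) * gear_X m l j)"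
    by (simp only: sum.distrib sum_subtractf sum_distrib_left)
  also have "(\<Sum>l<2*m+1. (\<Sum>s<m. gear_pt m i s * gear_pt m l s) * gear_X m l j) =
     (\<Sum>s<m. gear_pt m i s * (\<Sum>l<2*m+1. gear_pt m l s * gear_X m l j))"
    unfolding sum_distrib_left sum_distrib_right by (subst sum.swap) (simp add: mult_ac)
  also have "\<dots> = (\<Sum>s<m. gear_pt m i s * (3 * b + 5 * c)
      + (- 1 / 2) * (gear_pt m i s * (\<Sum>t<m. cyc_kernel 1 m s t * gear_pt m j t)))"
    using sums(3) by (intro sum.cong refl) (simp only: lessThan_iff Nz, simp add: algebra_simps)
  also have "\<dots> = w * (3 * b + 5 * c)
      - 1 / 2 * (\<Sum>s<m. gear_pt m i s * (\<Sum>t<m. cyc_kernel 1 m s t * gear_pt m j t))"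
    unfolding sum.distrib sum_distrib_right[symmetric] sum_distrib_left[symmetric]
      w_def gear_wt_eq_sum[OF i m0] by simp
  finally have "(\<Sum>l<2*m+1. gear_D n $$ (i, l) * gear_X m l j) =
      (w * ((2 * real m + 1) * b + 3 * real m * c) + (3 * real m * b + 5 * real m * c) - 2 * w * (3 * b + 5 * c))
      + (\<Sum>s<m. gear_pt m i s * (\<Sum>t<m. cyc_kernel 1 m s t * gear_pt m j t))"
    unfolding sums(1,2) by simp
  \<comment> \<open>The part spanned by \<open>1\<close> and \<open>a\<close> must reproduce the
    inverse Gram coefficients of \<open>gear_proj\<close>.\<close>
  moreover have "w * ((2 * real m + 1) * b + 3 * real m * c) + (3 * real m * b + 5 * real m * c) - 2 * w * (3 * b + 5 * c)
     = (5 - 3 * (w + gear_wt m j) + (2 * real m + 1) / real m * w * gear_wt m j) / (real m + 5)"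
    unfolding b c gear_u_def gear_v_def using m0
    by (simp add: divide_simps) (simp add: algebra_simps power2_eq_square)
  ultimately show ?thesis by (simp add: gear_proj_def w_def)
qed

section \<open>The Moore--Penrose inverse\<close>

theorem theorem1:
  fixes n :: nat
  assumes "n \<ge> 4" and "even n"
  shows "mp_inverse (gear_D n) =
    (- 1 / 2) \<cdot>\<^sub>m L_even n
      + ((real n - 1) / 2) \<cdot>\<^sub>m (u_vec n * transpose_mat (u_vec n))"
proof -
  define m where "m = n - 1"
  have m: "odd m" "2*n-1 = 2*m+1" using assms by (auto simp: m_def)
  define N where "N = 2*m+1"
  define D where "D = gear_D n"
  define X where "X = mat N N (\<lambda>(i, j). gear_X m i j)"
  define E where "E = mat N N (\<lambda>(i, j). gear_proj m i j)"
  have c: "D \<in> carrier_mat N N" "X \<in> carrier_mat N N" "E \<in> carrier_mat N N"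
    unfolding D_def gear_D_def m(2) X_def E_def N_def by simp_all
  have D: "D $$ (i, j) = gear_wt m i + gear_wt m j - 2 * (\<Sum>s<m. gear_pt m i s * gear_pt m j s)"
    if "i < N" "j < N" for i j
    using gear_D_index[OF assms(1) m_def] that by (simp add: D_def N_def)
  have mult: "(P * Q) $$ (i, j) = (\<Sum>l<N. P $$ (i, l) * Q $$ (l, j))"
    if "P \<in> carrier_mat N N" "Q \<in> carrier_mat N N" "i < N" "j < N" for P Q :: "real mat" and i j
    using that by (simp add: scalar_prod_def atLeast0LessThan)
  have Dt: "transpose_mat D = D"
    by (rule eq_matI) (use c(1) D in \<open>auto simp: mult.commute\<close>)
  have Xt: "transpose_mat X = X"
    by (rule eq_matI) (auto simp: X_def gear_X_sym)
  have Et: "transpose_mat E = E"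
    by (rule eq_matI) (auto simp: E_def gear_proj_sym)
  have DX: "D * X = E"
  proof (rule eq_matI)
    fix i j assume "i < dim_row E" "j < dim_col E"
    then have ij: "i < N" "j < N" using c by auto
    have "(D * X) $$ (i, j) = (\<Sum>l<2*m+1. gear_D n $$ (i, l) * gear_X m l j)"
      unfolding mult[OF c(1,2) ij] N_def[symmetric] D_def[symmetric] using ij
      by (intro sum.cong refl) (simp add: X_def)
    also have "\<dots> = E $$ (i, j)"
      using gear_D_times_X[OF assms(1) m_def] ij by (simp only: N_def[symmetric]) (simp add: E_def)
    finally show "(D * X) $$ (i, j) = E $$ (i, j)" .
  qed (use c in auto)
  \<comment> \<open>\<open>gear_proj_fixes\<close> applied column by column, stated once for both
    \<open>D\<close> and \<open>X\<close>.\<close>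
  have fixes_E: "E * Y = Y"
    if Y: "Y \<in> carrier_mat N N" and
      span: "\<And>j. j < N \<Longrightarrow> \<exists>b c z. \<forall>l<N. Y $$ (l, j) = b + c * gear_wt m l + (\<Sum>s<m. gear_pt m l s * z s)"
    for Y :: "real mat"
  proof (rule eq_matI)
    fix i j assume "i < dim_row Y" "j < dim_col Y"
    then have ij: "i < N" "j < N" using Y by auto
    obtain b c' z where "\<forall>l<N. Y $$ (l, j) = b + c' * gear_wt m l + (\<Sum>s<m. gear_pt m l s * z s)"
      using span[OF ij(2)] by blast
    then have "(\<Sum>l<N. gear_proj m i l * Y $$ (l, j)) = Y $$ (i, j)"
      using gear_proj_fixes[OF m(1), of i "\<lambda>l. Y $$ (l, j)"] ij unfolding N_def by blast
    moreover have "(E * Y) $$ (i, j) = (\<Sum>l<N. gear_proj m i l * Y $$ (l, j))"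
      unfolding mult[OF c(3) Y ij] using ij by (intro sum.cong refl) (simp add: E_def)
    ultimately show "(E * Y) $$ (i, j) = Y $$ (i, j)" by simp
  qed (use c Y in auto)
  have ED: "E * D = D"
  proof (rule fixes_E[OF c(1)])
    fix j assume "j < N"
    then have D_col: "D $$ (l, j) = gear_wt m j + 1 * gear_wt m l + (\<Sum>s<m. gear_pt m l s * (- 2 * gear_pt m j s))"
      if "l < N" for l
      using D[OF that] by (simp add: sum_distrib_left mult_ac sum_negf)
    show "\<exists>b c z. \<forall>l<N. D $$ (l, j) = b + c * gear_wt m l + (\<Sum>s<m. gear_pt m l s * z s)"
      by (intro exI allI impI, rule D_col)
  qed
  have EX: "E * X = X"
  proof (rule fixes_E[OF c(2)])
    fix j assume "j < N"
    then have X: "X $$ (l, j) = gear_X m l j" if "l < N" for l using that by (simp add: X_def)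
    show "\<exists>b c z. \<forall>l<N. X $$ (l, j) = b + c * gear_wt m l + (\<Sum>s<m. gear_pt m l s * z s)"
      by (intro exI allI impI, subst X, assumption, rule gear_X_column)
  qed
  \<comment> \<open>All three matrices are symmetric, so transposing \<open>D X = E\<close> and
    \<open>E X = X\<close> yields \<open>X D = E\<close> and \<open>X E = X\<close>.\<close>
  have XD: "X * D = E" using transpose_mult[OF c(1,2)] by (simp add: DX Dt Xt Et)
  have "X * E = X" using transpose_mult[OF c(3,2)] by (simp add: EX Xt Et)
  moreover have "X * D * X = X * (D * X)" using assoc_mult_mat[OF c(2,1,2)] .
  ultimately have "is_mp_inverse D X"
    unfolding is_mp_inverse_def using c by (simp add: DX XD ED Et EX)
  then have "mp_inverse (gear_D n) = X" unfolding D_def by (rule mp_inverse_eqI)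
  then show ?thesis
    unfolding inverse_formula_eq[OF assms m_def] X_def N_def .
qed

end
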